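(* Let $n\ge 1$ and let the exponents $p,r$ satisfy $$\frac1p,\ \frac1r\in\left(-\frac1n,\,1\right],$$ and let $a,c\in\mathbb{R}$. Let $\Omega\subset\mathbb{R}^n\setminus\{0\}$ be a bounded open set, let $\lambda\in(0,1)$, and define $q$ and $b$ by $$\frac1q=\frac{1-\lambda}{p}+\frac{\lambda}{r},\qquad b=(1-\lambda)a+\lambda c .$$ Then there exists a constant $C>0$, depending only on $(n,p,r,q,a,b,c,\lambda)$ and on $\Omega$, such that every $u\in C_c^\infty(\Omega)$ with $u\in X^{0,p,a}(\mathbb{R}^n)\cap X^{0,r,c}(\mathbb{R}^n)$ satisfies $u\in X^{0,q,b}(\mathbb{R}^n)$ and $$\big\||x|^{-b}u\big\|_{X^q(\mathbb{R}^n)}\le C\,\big\||x|^{-a}u\big\|_{X^p(\mathbb{R}^n)}^{1-\lambda}\,\big\||x|^{-c}u\big\|_{X^r(\mathbb{R}^n)}^{\lambda}.$$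
   Context: Exponents are parametrized by their reciprocals: $1/p$ is a real number, $1/p=0$ means $p=\infty$, and $1/p<0$ means $p$ is a negative real number. Unified scale $X^p(\Omega)$ for an open set $\Omega\subset\mathbb{R}^n$ (including $\Omega=\mathbb{R}^n$): - if $0<p<\infty$, $X^p(\Omega)=L^p(\Omega)$ with $\|u\|_{X^p(\Omega)}=\left(\int_\Omega|u|^p\,dx\right)^{1/p}$; - if $p=\infty$, $X^\infty(\Omega)=L^\infty(\Omega)$ with the essential supremum norm; - if $-\infty<p<0$, put $(p)_1=-\left[\frac np+1\right]$ (with $[\cdot]$ the integer part, i.e. floor) and $(p)_2=-\frac np-(p)_1\in(0,1]$; then $X^p(\Omega)=C^{(p)_1,(p)_2}(\Omega)$ with $$\|u\|_{X^p(\Omega)}=\max_{|\alpha|\le (p)_1}\sup_{x\in\Omega}|D^\alpha u(x)|+\sum_{|\alpha|=(p)_1}\sup_{x,y\in\Omega,\ x\neq y}\frac{|D^\alpha u(x)-D^\alpha u(y)|}{|x-y|^{(p)_2}}.$$ (In particular, for $-\frac1n<\frac1p<0$ one has $(p)_1=0$ and $(p)_2=-\frac np\in(0,1)$.) Weighted spaces: for $k\in\mathbb{N}_0$ and $a\in\mathbb{R}$, $$X^{k,p,a}(\Omega)=\{u:\ |x|^{-a}D^\alpha u\in X^p(\Omega)\ \text{for all multi-indices } |\alpha|\le k\}$$ (derivatives in the weak sense). Functions in $C_c^\infty(\Omega)$, and their products with powers of $|x|$, are extended by zero to $\mathbb{R}^n$. *)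

theory Defs
  imports "HOL-Analysis.Analysis" "HOL-Probability.Essential_Supremum"
begin

subsection \<open>Partial derivatives and test functions\<close>

definition partial :: "'n \<Rightarrow> (real^'n \<Rightarrow> real) \<Rightarrow> real^'n \<Rightarrow> real" where
  "partial i u x = deriv (\<lambda>t. u (x + t *\<^sub>R axis i 1)) 0"

primrec iter_partial :: "'n list \<Rightarrow> (real^'n \<Rightarrow> real) \<Rightarrow> real^'n \<Rightarrow> real" where
  "iter_partial [] u = u"
| "iter_partial (i # is) u = partial i (iter_partial is u)"

definition Ck_on :: "nat \<Rightarrow> (real^'n) set \<Rightarrow> (real^'n \<Rightarrow> real) \<Rightarrow> bool" where
  "Ck_on k \<Omega> u \<longleftrightarrow>
     (\<forall>is. length is \<le> k \<longrightarrow> continuous_on \<Omega> (iter_partial is u)) \<and>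
     (\<forall>is i. length is < k \<longrightarrow>
        (\<forall>x\<in>\<Omega>. (\<lambda>t. iter_partial is u (x + t *\<^sub>R axis i 1)) differentiable (at 0)))"

text \<open>Multi-indices are functions \<open>\<alpha> :: 'n \<Rightarrow> nat\<close>, with order \<open>\<Sum>i\<in>UNIV. \<alpha> i\<close>. The index type
  carries no order, so the order of differentiation is chosen arbitrarily; the choice is
  immaterial for functions of class \<open>C\<^sup>k\<close> with \<open>k\<close> at least the order of \<open>\<alpha>\<close>, the only ones to
  which \<open>mderiv \<alpha>\<close> is applied below.\<close>

definition mderiv :: "('n \<Rightarrow> nat) \<Rightarrow> (real^'n \<Rightarrow> real) \<Rightarrow> real^'n \<Rightarrow> real" where
  "mderiv \<alpha> u = iter_partial (SOME is. \<forall>i. count_list is i = \<alpha> i) u"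

text \<open>\<open>C\<^sub>c\<^sup>\<infinity>(\<Omega>)\<close>, its elements being extended by zero to the whole space.\<close>

definition Cc_smooth :: "(real^'n) set \<Rightarrow> (real^'n \<Rightarrow> real) set" where
  "Cc_smooth \<Omega> = {u. (\<forall>k. Ck_on k UNIV u) \<and>
     compact (closure {x. u x \<noteq> 0}) \<and> closure {x. u x \<noteq> 0} \<subseteq> \<Omega>}"

definition weak_deriv ::
  "(real^'n) set \<Rightarrow> ('n \<Rightarrow> nat) \<Rightarrow> (real^'n \<Rightarrow> real) \<Rightarrow> (real^'n \<Rightarrow> real) \<Rightarrow> bool" where
  "weak_deriv \<Omega> \<alpha> u v \<longleftrightarrow>
     (\<forall>K. compact K \<and> K \<subseteq> \<Omega> \<longrightarrow> integrable (lebesgue_on K) u \<and> integrable (lebesgue_on K) v) \<and>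
     (\<forall>\<phi>\<in>Cc_smooth \<Omega>.
        (\<integral>x. u x * mderiv \<alpha> \<phi> x \<partial>lebesgue_on \<Omega>) =
        (-1) ^ (\<Sum>i\<in>UNIV. \<alpha> i) * (\<integral>x. v x * \<phi> x \<partial>lebesgue_on \<Omega>))"

subsection \<open>The unified scale\<close>

text \<open>Throughout, the parameter \<open>s\<close> stands for \<open>1/p\<close>: \<open>s > 0\<close> is the Lebesgue range,
  \<open>s = 0\<close> means \<open>p = \<infinity>\<close>, and \<open>s < 0\<close> is the Hoelder range, where \<open>n/p = CARD('n) * s\<close>.
  Sets \<open>\<Omega>\<close> are meant to be open and nonempty.\<close>

definition hoelder_order :: "'n::finite itself \<Rightarrow> real \<Rightarrow> nat" where
  "hoelder_order _ s = nat (- \<lfloor>real CARD('n) * s + 1\<rfloor>)"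

definition hoelder_exp :: "'n::finite itself \<Rightarrow> real \<Rightarrow> real" where
  "hoelder_exp _ s = - real CARD('n) * s - real (hoelder_order TYPE('n) s)"

definition hoelder_quotients :: "(real^'n) set \<Rightarrow> real \<Rightarrow> (real^'n \<Rightarrow> real) \<Rightarrow> real set" where
  "hoelder_quotients \<Omega> \<gamma> f =
     {\<bar>f x - f y\<bar> / norm (x - y) powr \<gamma> | x y. x \<in> \<Omega> \<and> y \<in> \<Omega> \<and> x \<noteq> y}"

definition X_space :: "real \<Rightarrow> (real^'n) set \<Rightarrow> (real^'n \<Rightarrow> real) set" where
  "X_space s \<Omega> =
    (if s > 0 then
       {u. u \<in> borel_measurable (lebesgue_on \<Omega>) \<and>
           integrable (lebesgue_on \<Omega>) (\<lambda>x. \<bar>u x\<bar> powr (1 / s))}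
     else if s = 0 then
       {u. u \<in> borel_measurable (lebesgue_on \<Omega>) \<and>
           esssup (lebesgue_on \<Omega>) (\<lambda>x. ereal \<bar>u x\<bar>) < \<infinity>}
     else
       {u. Ck_on (hoelder_order TYPE('n) s) \<Omega> u \<and>
           (\<forall>\<alpha>. (\<Sum>i\<in>UNIV. \<alpha> i) \<le> hoelder_order TYPE('n) s \<longrightarrow>
              bdd_above ((\<lambda>x. \<bar>mderiv \<alpha> u x\<bar>) ` \<Omega>)) \<and>
           (\<forall>\<alpha>. (\<Sum>i\<in>UNIV. \<alpha> i) = hoelder_order TYPE('n) s \<longrightarrow>
              bdd_above (hoelder_quotients \<Omega> (hoelder_exp TYPE('n) s) (mderiv \<alpha> u)))})"

text \<open>Meaningful for \<open>u \<in> X_space s \<Omega>\<close>.\<close>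

definition X_norm :: "real \<Rightarrow> (real^'n) set \<Rightarrow> (real^'n \<Rightarrow> real) \<Rightarrow> real" where
  "X_norm s \<Omega> u =
    (if s > 0 then
       (\<integral>x. \<bar>u x\<bar> powr (1 / s) \<partial>lebesgue_on \<Omega>) powr s
     else if s = 0 then
       real_of_ereal (esssup (lebesgue_on \<Omega>) (\<lambda>x. ereal \<bar>u x\<bar>))
     else
       Max ((\<lambda>\<alpha>. SUP x\<in>\<Omega>. \<bar>mderiv \<alpha> u x\<bar>) `
              {\<alpha>. (\<Sum>i\<in>UNIV. \<alpha> i) \<le> hoelder_order TYPE('n) s}) +
       (\<Sum>\<alpha> | (\<Sum>i\<in>UNIV. \<alpha> i) = hoelder_order TYPE('n) s.
          Sup (hoelder_quotients \<Omega> (hoelder_exp TYPE('n) s) (mderiv \<alpha> u))))"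

text \<open>Weighted spaces \<open>X\<^sup>k\<^sup>,\<^sup>p\<^sup>,\<^sup>a(\<Omega>)\<close>. A weak derivative is only determined almost everywhere, and
  \<open>\<bar>x\<bar>\<^sup>-\<^sup>a\<close> need not make sense at the origin (moreover \<open>0 powr 0 = 0\<close>); hence
  \<open>\<bar>x\<bar>\<^sup>-\<^sup>a D\<^sup>\<alpha>u \<in> X\<^sup>p(\<Omega>)\<close> is read as an almost-everywhere statement, with representative \<open>w\<close>.\<close>

definition X_weighted :: "nat \<Rightarrow> real \<Rightarrow> real \<Rightarrow> (real^'n) set \<Rightarrow> (real^'n \<Rightarrow> real) set" where
  "X_weighted k s a \<Omega> =
     {u. \<forall>\<alpha>. (\<Sum>i\<in>UNIV. \<alpha> i) \<le> k \<longrightarrow>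
        (\<exists>v w. weak_deriv \<Omega> \<alpha> u v \<and> w \<in> X_space s \<Omega> \<and>
           (AE x in lebesgue_on \<Omega>. w x = norm x powr (- a) * v x))}"

end

theory Submission
  imports Defs
begin

text \<open>Write \<open>s = 1/p\<close>, \<open>t = 1/r\<close>, \<open>\<gamma> = - n s\<close> (the Hoelder exponent if \<open>s < 0\<close>) and
  \<open>weighted a u = \<bar>x\<bar>\<^sup>-\<^sup>a u\<close>. The difficulty is that the three norms carry three different weights and may be of different nature (Lebesgue or Hoelder). The
  identity \<open>\<bar>weighted b u\<bar> = \<bar>weighted a u\<bar>\<^sup>1\<^sup>-\<^sup>l \<bar>weighted c u\<bar>\<^sup>l\<close> settles the Lebesgue range by Hoelder's
  inequality, but says nothing about differences of \<open>weighted b u\<close>.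

  For the Hoelder range, the condition is restated in the scale-invariant form \<open>scaled_hoelder\<close>:
  \<open>\<bar>u x\<bar> \<le> A \<bar>x\<bar>\<^sup>e\<^sup>+\<^sup>\<gamma>\<close> for all \<open>x \<noteq> 0\<close>, and \<open>\<bar>u x - u y\<bar> \<le> A \<bar>x\<bar>\<^sup>e \<bar>x - y\<bar>\<^sup>\<gamma>\<close> whenever \<open>\<bar>x - y\<bar> \<le> \<bar>x\<bar>/2\<close>.
  For a function vanishing at the origin this is equivalent, up to constants, to
  \<open>\<gamma>\<close>-Hoelder continuity of \<open>\<bar>x\<bar>\<^sup>-\<^sup>e u\<close>: nearby points have comparable weights, and for distant ones
  the pointwise bound is enough (\<open>scaled_hoelder_of_weighted\<close>, \<open>hoelder_of_scaled_hoelder\<close>). In this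
  form the weights stand outside the differences of \<open>u\<close>, so two such conditions are interpolated by
  multiplying powers of the inequalities (\<open>scaled_hoelder_interpolate\<close>). The value \<open>\<gamma> = 0\<close> covers
  sup bounds.

  In the mixed case \<open>t < 0 < s\<close> (the case \<open>s < 0 < t\<close> is symmetric), let \<open>\<theta> = s/(s - t)\<close> be the
  parameter at which the interpolated exponent is infinite. There a sup bound holds: if \<open>\<bar>u x\<bar>\<close> is large, the Hoelder condition keeps \<open>\<bar>u\<bar>\<close>
  above \<open>\<bar>u x\<bar>/2\<close> on a whole ball around \<open>x\<close> that lies at distance comparable to \<open>\<bar>x\<bar>\<close> from the origin,
  and this costs integral (\<open>mass_lower_bound\<close>, \<open>sup_bound_Lp_hoelder\<close>). All other parameters follow by
  reiteration: for \<open>l < \<theta>\<close> interpolate between the Lebesgue endpoint and this sup bound, for \<open>l > \<theta>\<close>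
  between the sup bound and the Hoelder endpoint (\<open>interpolates_reiterate\<close>).

  Finally, a test function on \<open>\<Omega>\<close> is Lipschitz and its support stays away from the origin, so all
  its weighted versions belong to all the spaces, and the suprema and integrals in their norms are finite.\<close>

section \<open>Power weights at comparable points\<close>

lemma powr_le_comparable:
  fixes r R m :: real
  assumes "0 < R" "R / 2 \<le> r" "r \<le> 2 * R"
  shows "r powr m \<le> 2 powr \<bar>m\<bar> * R powr m"
proof (cases "0 \<le> m")
  case True
  have "r powr m \<le> (2 * R) powr m"
    using assms True by (intro powr_mono2) auto
  then show ?thesis using True assms by (simp add: powr_mult)
next
  case False
  have "r powr m \<le> (R / 2) powr m"
    using assms False by (intro powr_mono2') auto
  also have "(R / 2) powr m = 2 powr \<bar>m\<bar> * R powr m"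
    using False assms by (simp add: powr_divide powr_minus_divide)
  finally show ?thesis .
qed

lemma powr_diff_le_comparable:
  fixes r R w :: real
  assumes "0 < R" "R / 2 \<le> r" "r \<le> 2 * R"
  shows "\<bar>R powr w - r powr w\<bar> \<le> \<bar>w\<bar> * 2 powr \<bar>w - 1\<bar> * R powr (w - 1) * \<bar>R - r\<bar>"
proof -
  have "norm (R powr w - r powr w) \<le> \<bar>w\<bar> * 2 powr \<bar>w - 1\<bar> * R powr (w - 1) * norm (R - r)"
  proof (rule field_differentiable_bound[of "{R/2..2*R}" "\<lambda>t. t powr w" "\<lambda>t. w * t powr (w - 1)"])
    fix z assume z: "z \<in> {R/2..2*R}"
    then have "z > 0" using assms by auto
    then show "((\<lambda>t. t powr w) has_field_derivative w * z powr (w - 1)) (at z within {R/2..2*R})"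
      by (auto intro!: derivative_eq_intros)
    have "z powr (w - 1) \<le> 2 powr \<bar>w - 1\<bar> * R powr (w - 1)"
      using z assms by (intro powr_le_comparable) auto
    then show "norm (w * z powr (w - 1)) \<le> \<bar>w\<bar> * 2 powr \<bar>w - 1\<bar> * R powr (w - 1)"
      by (simp add: abs_mult mult.assoc mult_left_mono)
  qed (use assms in auto)
  then show ?thesis by simp
qed

text \<open>The factor \<open>\<bar>w\<bar> 2\<^sup>\<bar>\<^sup>w\<^sup>-\<^sup>1\<^sup>\<bar>\<close> comes from the mean value theorem for the weight, and the last one from comparing
  the size bound at \<open>y\<close>, of exponent \<open>m\<close>, with the one at \<open>x\<close>.\<close>

definition weight_const :: "real \<Rightarrow> real \<Rightarrow> real" where
  "weight_const w m = 1 + \<bar>w\<bar> * 2 powr \<bar>w - 1\<bar> * 2 powr \<bar>m\<bar>"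

lemma weight_const_ge_1: "1 \<le> weight_const w m"
  by (simp add: weight_const_def)

lemma norm_comparable:
  fixes x y :: "'a::real_normed_vector"
  assumes "norm (x - y) \<le> norm x / 2"
  shows "norm x / 2 \<le> norm y" "norm y \<le> 2 * norm x"
  using assms norm_triangle_ineq2[of x y] norm_triangle_ineq2[of y x] norm_ge_zero[of x]
  by (simp_all add: norm_minus_commute)

text \<open>Multiplying by a power weight preserves a local Hoelder estimate: on \<open>\<bar>x - y\<bar> \<le> \<bar>x\<bar>/2\<close> the weight varies
  by a relative amount of order \<open>\<bar>x - y\<bar>/\<bar>x\<bar> \<le> (\<bar>x - y\<bar>/\<bar>x\<bar>)\<^sup>g\<close>, and the size bound on \<open>t\<close> turns this into
  the right power of \<open>\<bar>x - y\<bar>\<close>. It is used both to remove a weight (\<open>e = 0\<close>) and to put one on.\<close>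

lemma weight_increment:
  fixes x y :: "'a::real_normed_vector"
  assumes xy: "x \<noteq> 0" "x \<noteq> y" "norm (x - y) \<le> norm x / 2" and g: "g \<le> 1"
    and inc: "\<bar>s - t\<bar> \<le> A * norm x powr e * norm (x - y) powr g"
    and size: "\<bar>t\<bar> \<le> A * norm y powr (e + g)"
  shows "\<bar>norm x powr w * s - norm y powr w * t\<bar>
          \<le> weight_const w (e + g) * A * norm x powr (e + w) * norm (x - y) powr g"
proof -
  define R r d where "R = norm x" and "r = norm y" and "d = norm (x - y)"
  have R: "R > 0" and d: "d > 0" "d \<le> R / 2" and r: "R / 2 \<le> r" "r \<le> 2 * R"
    using xy norm_comparable[of x y] by (auto simp: R_def r_def d_def)
  have rd: "\<bar>R - r\<bar> \<le> d" unfolding R_def r_def d_def by (rule norm_triangle_ineq3)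
  have "0 < r powr (e + g)" using R r by simp
  moreover have "0 \<le> A * r powr (e + g)" using size by (smt (verit) r_def)
  ultimately have A: "0 \<le> A" by (simp add: zero_le_mult_iff)
  define K where "K = \<bar>w\<bar> * 2 powr \<bar>w - 1\<bar>"
  define J where "J = 2 powr \<bar>e + g\<bar>"
  have KJ: "0 \<le> K" "0 \<le> J" by (auto simp: K_def J_def)
  \<comment> \<open>Since \<open>d \<le> R\<close>, the linear modulus of the weight is dominated by the power \<open>g \<le> 1\<close>.\<close>
  have "d / R \<le> (d / R) powr g"
    using powr_mono'[of g 1 "d / R"] g d R by simp
  then have dg: "R powr (g - 1) * d \<le> d powr g"
    using R d by (simp add: powr_diff powr_divide field_simps)
  have "\<bar>R powr w * s - r powr w * t\<bar> = \<bar>R powr w * (s - t) + (R powr w - r powr w) * t\<bar>"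
    by (simp add: algebra_simps)
  also have "\<dots> \<le> R powr w * \<bar>s - t\<bar> + \<bar>R powr w - r powr w\<bar> * \<bar>t\<bar>"
    using abs_triangle_ineq[of "R powr w * (s - t)" "(R powr w - r powr w) * t"]
    by (simp add: abs_mult)
  also have "\<dots> \<le> R powr w * (A * R powr e * d powr g)
      + (K * R powr (w - 1) * d) * (A * (J * R powr (e + g)))"
  proof (intro add_mono mult_mono)
    show "\<bar>s - t\<bar> \<le> A * R powr e * d powr g" using inc by (simp add: R_def d_def)
    have "\<bar>R powr w - r powr w\<bar> \<le> K * R powr (w - 1) * \<bar>R - r\<bar>"
      unfolding K_def using powr_diff_le_comparable[OF R r] .
    also have "\<dots> \<le> K * R powr (w - 1) * d" using rd KJ by (intro mult_left_mono) auto
    finally show "\<bar>R powr w - r powr w\<bar> \<le> K * R powr (w - 1) * d" .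
    have "\<bar>t\<bar> \<le> A * r powr (e + g)" using size by (simp add: r_def)
    also have "\<dots> \<le> A * (J * R powr (e + g))"
      unfolding J_def using powr_le_comparable[OF R r] A by (intro mult_left_mono) auto
    finally show "\<bar>t\<bar> \<le> A * (J * R powr (e + g))" .
  qed (use A KJ d in auto)
  also have "\<dots> = A * R powr (e + w) * d powr g + K * J * A * R powr (e + w) * (R powr (g - 1) * d)"
  proof -
    have *: "R powr (w - 1) * R powr (e + g) = R powr (e + w) * R powr (g - 1)"
      by (simp flip: powr_add add: algebra_simps)
    have "K * R powr (w - 1) * d * (A * (J * R powr (e + g)))
      = K * J * A * d * (R powr (w - 1) * R powr (e + g))" by (simp only: mult_ac)
    then show ?thesis unfolding * by (simp add: powr_add mult_ac)
  qed
  also have "\<dots> \<le> A * R powr (e + w) * d powr g + K * J * A * R powr (e + w) * d powr g"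
    using dg A KJ by (intro add_left_mono mult_left_mono) auto
  also have "\<dots> = weight_const w (e + g) * A * R powr (e + w) * d powr g"
    by (simp add: weight_const_def K_def J_def algebra_simps)
  finally show ?thesis by (simp add: R_def r_def d_def)
qed

section \<open>A scale-invariant form of the weighted Hoelder condition\<close>

text \<open>The condition is invariant under dilations in the sense that rescaling to \<open>\<bar>x\<bar> = 1\<close> only changes \<open>A\<close>;
  \<open>e\<close> is the weight exponent and \<open>g\<close> the Hoelder exponent. The size bound is what \<open>g\<close>-Hoelder continuity
  of \<open>\<bar>x\<bar>\<^sup>-\<^sup>e u\<close> gives when compared with the value \<open>0\<close> at the origin.\<close>

definition scaled_hoelder :: "real \<Rightarrow> real \<Rightarrow> real \<Rightarrow> ('a::real_normed_vector \<Rightarrow> real) \<Rightarrow> bool" where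
  "scaled_hoelder g e A u \<longleftrightarrow>
     (\<forall>x. x \<noteq> 0 \<longrightarrow> \<bar>u x\<bar> \<le> A * norm x powr (e + g)) \<and>
     (\<forall>x y. x \<noteq> 0 \<longrightarrow> x \<noteq> y \<longrightarrow> norm (x - y) \<le> norm x / 2 \<longrightarrow>
        \<bar>u x - u y\<bar> \<le> A * norm x powr e * norm (x - y) powr g)"

text \<open>With \<open>x \<noteq> y\<close> the case \<open>g = 0\<close> is a bound on the oscillation of \<open>f\<close>.\<close>

definition hoelder_bound :: "real \<Rightarrow> real \<Rightarrow> ('a::real_normed_vector \<Rightarrow> real) \<Rightarrow> bool" where
  "hoelder_bound g A f \<longleftrightarrow> (\<forall>x y. x \<noteq> y \<longrightarrow> \<bar>f x - f y\<bar> \<le> A * norm (x - y) powr g)"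

definition weighted :: "real \<Rightarrow> ('a::real_normed_vector \<Rightarrow> real) \<Rightarrow> 'a \<Rightarrow> real" where
  "weighted a u = (\<lambda>x. norm x powr (- a) * u x)"

lemma weighted_at_0 [simp]: "weighted a u 0 = 0"
  by (simp add: weighted_def)

lemma unweight: "x \<noteq> 0 \<Longrightarrow> norm x powr a * weighted a u x = u x"
  by (simp add: weighted_def powr_minus)

text \<open>The size bound compares \<open>x\<close> with the origin, where \<open>weighted a u\<close> vanishes because \<open>0 powr z = 0\<close>.\<close>

lemma scaled_hoelder_of_weighted:
  fixes u :: "'a::real_normed_vector \<Rightarrow> real"
  assumes h: "hoelder_bound g A (weighted a u)" and g: "g \<le> 1" and A: "0 \<le> A"
  shows "scaled_hoelder g a (weight_const a g * A) u"
proof -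
  have size: "\<bar>weighted a u x\<bar> \<le> A * norm x powr (0 + g)" if "x \<noteq> 0" for x
    using h[unfolded hoelder_bound_def, rule_format, OF that] by simp
  show ?thesis
    unfolding scaled_hoelder_def
  proof (intro conjI allI impI)
    fix x :: 'a assume x: "x \<noteq> 0"
    have "\<bar>u x\<bar> = norm x powr a * \<bar>weighted a u x\<bar>"
      using unweight[OF x, of a u] by (metis abs_mult abs_of_nonneg powr_ge_zero)
    also have "\<dots> \<le> norm x powr a * (A * norm x powr g)"
      using size[OF x] by (intro mult_left_mono) auto
    also have "\<dots> = 1 * A * norm x powr (a + g)" using x by (simp add: powr_add)
    also have "\<dots> \<le> weight_const a g * A * norm x powr (a + g)"
      using weight_const_ge_1[of a g] A by (intro mult_right_mono) auto
    finally show "\<bar>u x\<bar> \<le> weight_const a g * A * norm x powr (a + g)" .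
  next
    fix x y :: 'a assume xy: "x \<noteq> 0" "x \<noteq> y" "norm (x - y) \<le> norm x / 2"
    then have y: "y \<noteq> 0" by auto
    have "\<bar>weighted a u x - weighted a u y\<bar> \<le> A * norm x powr 0 * norm (x - y) powr g"
      using h xy by (auto simp: hoelder_bound_def)
    from weight_increment[OF xy g this size[OF y], of a]
    show "\<bar>u x - u y\<bar> \<le> weight_const a g * A * norm x powr a * norm (x - y) powr g"
      using xy y by (simp add: unweight)
  qed
qed

text \<open>For distant points, \<open>\<bar>x - y\<bar> > \<bar>x\<bar>/2\<close> with \<open>x\<close> the farther one from the origin, both values are
  individually at most \<open>A \<bar>x\<bar>\<^sup>g\<close>, hence at most a multiple of \<open>A \<bar>x - y\<bar>\<^sup>g\<close>.\<close>

lemma hoelder_of_scaled_hoelder: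
  fixes u :: "'a::real_normed_vector \<Rightarrow> real"
  assumes u: "scaled_hoelder g b A u" and g: "0 \<le> g" "g \<le> 1" and A: "0 \<le> A"
  shows "hoelder_bound g ((weight_const (- b) (b + g) + 4) * A) (weighted b u)"
proof -
  define C where "C = weight_const (- b) (b + g)"
  have C: "1 \<le> C" by (simp add: C_def weight_const_ge_1)
  have size: "\<bar>weighted b u x\<bar> \<le> A * norm x powr g" for x
  proof (cases "x = 0")
    case False
    then have "\<bar>u x\<bar> \<le> A * norm x powr (b + g)" using u by (simp add: scaled_hoelder_def)
    then have "norm x powr (- b) * \<bar>u x\<bar> \<le> norm x powr (- b) * (A * norm x powr (b + g))"
      by (intro mult_left_mono) auto
    also have "\<dots> = A * norm x powr g" using False by (simp add: powr_add powr_minus)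
    finally show ?thesis by (simp add: weighted_def abs_mult)
  qed simp
  have *: "\<bar>weighted b u x - weighted b u y\<bar> \<le> (C + 4) * A * norm (x - y) powr g"
    if "x \<noteq> y" and le: "norm y \<le> norm x" for x y
  proof (cases "norm (x - y) \<le> norm x / 2")
    case True
    have x: "x \<noteq> 0" using that by auto
    have y: "y \<noteq> 0" using True x by auto
    have "\<bar>u x - u y\<bar> \<le> A * norm x powr b * norm (x - y) powr g" "\<bar>u y\<bar> \<le> A * norm y powr (b + g)"
      using u x y that True by (auto simp: scaled_hoelder_def)
    from weight_increment[OF x \<open>x \<noteq> y\<close> True g(2) this, of "- b"]
    have "\<bar>weighted b u x - weighted b u y\<bar> \<le> C * A * norm (x - y) powr g"
      using x by (simp add: weighted_def C_def)
    also have "\<dots> \<le> (C + 4) * A * norm (x - y) powr g"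
      using A by (intro mult_right_mono) auto
    finally show ?thesis .
  next
    case False
    have "\<bar>weighted b u x - weighted b u y\<bar> \<le> A * norm x powr g + A * norm y powr g"
      using size[of x] size[of y] by linarith
    also have "\<dots> \<le> 2 * A * norm x powr g"
      using mult_left_mono[OF powr_mono2[OF g(1) norm_ge_zero le] A] by simp
    also have "\<dots> \<le> 2 * A * (2 * norm (x - y)) powr g"
      using False g A by (intro mult_left_mono powr_mono2) auto
    also have "\<dots> = (2 powr g * 2) * A * norm (x - y) powr g" by (simp add: powr_mult)
    also have "\<dots> \<le> (C + 4) * A * norm (x - y) powr g"
      using powr_mono[of g 1 2] g C A by (intro mult_right_mono) auto
    finally show ?thesis .
  qed
  show ?thesis
    unfolding hoelder_bound_def C_def[symmetric]
    using * by (metis abs_minus_commute linorder_linear norm_minus_commute)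
qed

lemma le_powr_interpolate:
  fixes z P Q l :: real
  assumes "0 \<le> z" "z \<le> P" "z \<le> Q" "0 \<le> l" "l \<le> 1"
  shows "z \<le> P powr (1 - l) * Q powr l"
proof -
  have "z = z powr (1 - l) * z powr l" using assms by (simp flip: powr_add)
  also have "\<dots> \<le> P powr (1 - l) * Q powr l"
    using assms by (intro mult_mono powr_mono2) auto
  finally show ?thesis .
qed

lemma powr_interpolate_mult:
  fixes A B R p q l :: real
  assumes "0 \<le> A" "0 \<le> B"
  shows "(A * R powr p) powr (1 - l) * (B * R powr q) powr l
    = A powr (1 - l) * B powr l * R powr ((1 - l) * p + l * q)"
  using assms by (simp add: powr_mult powr_powr powr_add mult_ac)

text \<open>Each of the two defining inequalities bounds a single number by two products of powers of the same
  quantities, so a geometric mean of the two bounds is again a bound.\<close>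

lemma scaled_hoelder_interpolate:
  fixes u :: "'a::real_normed_vector \<Rightarrow> real"
  assumes "scaled_hoelder g0 a A u" "scaled_hoelder g1 c B u" "0 \<le> l" "l \<le> 1" "0 \<le> A" "0 \<le> B"
  shows "scaled_hoelder ((1 - l) * g0 + l * g1) ((1 - l) * a + l * c) (A powr (1 - l) * B powr l) u"
  unfolding scaled_hoelder_def
proof (intro conjI allI impI)
  fix x :: 'a assume x: "x \<noteq> 0"
  have "\<bar>u x\<bar> \<le> (A * norm x powr (a + g0)) powr (1 - l) * (B * norm x powr (c + g1)) powr l"
    using assms x by (intro le_powr_interpolate) (auto simp: scaled_hoelder_def)
  also have "\<dots> = A powr (1 - l) * B powr l * norm x powr (((1 - l) * a + l * c) + ((1 - l) * g0 + l * g1))"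
    using assms by (simp add: powr_interpolate_mult) (simp add: algebra_simps)
  finally show "\<bar>u x\<bar> \<le> A powr (1 - l) * B powr l * norm x powr (((1 - l) * a + l * c) + ((1 - l) * g0 + l * g1))" .
next
  fix x y :: 'a assume xy: "x \<noteq> 0" "x \<noteq> y" "norm (x - y) \<le> norm x / 2"
  have "\<bar>u x - u y\<bar> \<le> (A * norm x powr a * norm (x - y) powr g0) powr (1 - l)
     * (B * norm x powr c * norm (x - y) powr g1) powr l"
    using assms xy by (intro le_powr_interpolate) (auto simp: scaled_hoelder_def)
  also have "\<dots> = A powr (1 - l) * B powr l * norm x powr ((1 - l) * a + l * c)
     * norm (x - y) powr ((1 - l) * g0 + l * g1)"
    using assms by (simp add: powr_interpolate_mult powr_mult powr_powr powr_add mult_ac)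
  finally show "\<bar>u x - u y\<bar> \<le> A powr (1 - l) * B powr l * norm x powr ((1 - l) * a + l * c)
     * norm (x - y) powr ((1 - l) * g0 + l * g1)" .
qed

section \<open>A sup bound from integrability and Hoelder continuity\<close>

text \<open>The radius \<open>rho\<close> is chosen so that the Hoelder condition allows \<open>u\<close> to drop by at most \<open>\<bar>u x\<bar>/2\<close> on the
  ball around \<open>x\<close>. The size bound in \<open>scaled_hoelder\<close> forces \<open>rho \<le> \<bar>x\<bar>/2\<close>, so the condition applies on
  this ball and the weight is comparable to its value at \<open>x\<close>.\<close>

lemma mass_lower_bound:
  fixes u :: "'a::euclidean_space \<Rightarrow> real"
  assumes u: "scaled_hoelder g c B u" and g: "0 < g" "g \<le> 1" and B: "0 < B" and s: "0 < s"
    and int: "integrable lebesgue (\<lambda>x. \<bar>weighted a u x\<bar> powr (1 / s))"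
    and x: "x \<noteq> 0" "u x \<noteq> 0"
    and rho: "rho = (\<bar>u x\<bar> / (2 * B * norm x powr c)) powr (1 / g)"
  shows "norm x powr (- a) * \<bar>u x\<bar> / 2 powr (\<bar>a\<bar> + 1)
           * (unit_ball_vol (real DIM('a)) * rho ^ DIM('a)) powr s
         \<le> (\<integral>x. \<bar>weighted a u x\<bar> powr (1 / s) \<partial>lebesgue) powr s"
proof -
  define R U where "R = norm x" and "U = \<bar>u x\<bar>"
  have R: "R > 0" and U: "U > 0" using x by (auto simp: R_def U_def)
  have BR: "0 < B * R powr c" using B R by simp
  have rho_pos: "0 < rho" using U B R by (simp add: rho R_def[symmetric] U_def[symmetric])
  have rho_g: "B * R powr c * rho powr g = U / 2"
    using U B R g by (simp add: rho powr_powr R_def[symmetric] U_def[symmetric])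
  have "U \<le> B * R powr (c + g)" using u x by (simp add: scaled_hoelder_def R_def U_def)
  then have "B * R powr c * rho powr g \<le> B * R powr c * (R powr g / 2)"
    using rho_g by (simp add: powr_add)
  then have "rho powr g \<le> R powr g / 2" using BR mult_le_cancel_left_pos by blast
  \<comment> \<open>This is where \<open>g \<le> 1\<close> is used: \<open>2 powr g \<le> 2\<close>.\<close>
  also have "\<dots> \<le> R powr g / 2 powr g"
    using powr_mono[of g 1 2] g by (intro divide_left_mono) auto
  also have "\<dots> = (R / 2) powr g" using R by (simp add: powr_divide)
  finally have rho_le: "rho \<le> R / 2"
    using powr_less_mono2[of g "R / 2" rho] g R by (meson not_less divide_nonneg_nonneg less_imp_le zero_le_numeral)
  define L where "L = R powr (- a) * U / 2 powr (\<bar>a\<bar> + 1)"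
  have L: "L > 0" using R U by (simp add: L_def)
  have low: "L \<le> \<bar>weighted a u y\<bar>" if y: "y \<in> ball x rho" for y
  proof -
    have d: "norm (x - y) < rho" using y by (simp add: dist_norm)
    then have d2: "norm (x - y) \<le> norm x / 2" using rho_le by (simp add: R_def)
    have "U / 2 \<le> \<bar>u y\<bar>"
    proof (cases "y = x")
      case False
      have "\<bar>u x - u y\<bar> \<le> B * R powr c * norm (x - y) powr g"
        using u x d2 False by (simp add: scaled_hoelder_def R_def)
      also have "\<dots> \<le> B * R powr c * rho powr g"
        using d g BR by (intro mult_left_mono powr_mono2) auto
      finally show ?thesis using rho_g unfolding U_def by linarith
    qed (use U in \<open>simp add: U_def\<close>)
    moreover have "R powr (- a) \<le> 2 powr \<bar>- a\<bar> * norm y powr (- a)"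
      using norm_comparable[OF d2] R by (intro powr_le_comparable) (auto simp: R_def)
    ultimately have "R powr (- a) * (U / 2) \<le> (2 powr \<bar>a\<bar> * norm y powr (- a)) * \<bar>u y\<bar>"
      using U by (intro mult_mono) auto
    then show ?thesis
      by (simp add: L_def weighted_def abs_mult powr_add pos_divide_le_eq mult_ac)
  qed
  define F where "F = (\<lambda>y. \<bar>weighted a u y\<bar> powr (1 / s))"
  have "L powr (1 / s) * measure lebesgue (ball x rho) = (\<integral>y. L powr (1 / s) * indicator (ball x rho) y \<partial>lebesgue)"
    by simp
  also have "\<dots> \<le> (\<integral>y. F y \<partial>lebesgue)"
  proof (rule integral_mono)
    show "integrable lebesgue (\<lambda>y. L powr (1 / s) * indicat_real (ball x rho) y)"
      using emeasure_bounded_finite[of "ball x rho"] by (intro integrable_mult_right integrable_real_indicator) auto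
    show "integrable lebesgue F" using int by (simp add: F_def)
    show "L powr (1 / s) * indicator (ball x rho) y \<le> F y" for y
      using low[of y] L s by (auto simp: F_def indicator_def intro!: powr_mono2)
  qed
  finally have "L powr (1 / s) * (unit_ball_vol (real DIM('a)) * rho ^ DIM('a)) \<le> integral\<^sup>L lebesgue F"
    using rho_pos content_ball[of rho x] by (simp add: measure_completion)
  then have "(L powr (1 / s) * (unit_ball_vol (real DIM('a)) * rho ^ DIM('a))) powr s
      \<le> (integral\<^sup>L lebesgue F) powr s"
    using s rho_pos L by (intro powr_mono2) auto
  moreover have "(L powr (1 / s) * (unit_ball_vol (real DIM('a)) * rho ^ DIM('a))) powr s
      = L * (unit_ball_vol (real DIM('a)) * rho ^ DIM('a)) powr s"
    using s L rho_pos by (simp add: powr_mult powr_powr)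
  ultimately show ?thesis by (simp add: F_def L_def R_def U_def)
qed

text \<open>This solves the inequality of \<open>mass_lower_bound\<close> for \<open>\<bar>u x\<bar>\<close>: since \<open>rho\<^sup>n\<^sup>s\<close> is proportional to \<open>\<bar>u x\<bar>\<^sup>m\<close>, it
  bounds \<open>\<bar>u x\<bar>\<^sup>1\<^sup>+\<^sup>m\<close>. With \<open>g = - n t\<close> one has \<open>m/(1 + m) = s/(s - t)\<close>.\<close>

lemma sup_bound_Lp_hoelder:
  fixes u :: "'a::euclidean_space \<Rightarrow> real"
  assumes u: "scaled_hoelder g c B u" and g: "0 < g" "g \<le> 1" and B: "0 \<le> B" and s: "0 < s"
    and int: "integrable lebesgue (\<lambda>x. \<bar>weighted a u x\<bar> powr (1 / s))"
    and N: "(\<integral>x. \<bar>weighted a u x\<bar> powr (1 / s) \<partial>lebesgue) powr s \<le> N"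
    and m: "m = real DIM('a) * s / g"
    and x: "x \<noteq> 0"
  shows "\<bar>u x\<bar> \<le> (2 powr (\<bar>a\<bar> + 1 + m) / unit_ball_vol (real DIM('a)) powr s) powr (1 / (1 + m))
    * (N powr (1 / (1 + m)) * B powr (m / (1 + m))) * norm x powr ((a + m * c) / (1 + m))"
proof (cases "u x = 0")
  case False
  define R U v where "R = norm x" and "U = \<bar>u x\<bar>" and "v = unit_ball_vol (real DIM('a))"
  have R: "R > 0" and U: "U > 0" and v: "v > 0" using x False by (auto simp: R_def U_def v_def)
  have m0: "0 \<le> m" using g s m by simp
  have N0: "0 \<le> N" using N by (meson order_trans powr_ge_zero)
  have "U \<le> B * R powr (c + g)" using u x by (simp add: scaled_hoelder_def R_def U_def)
  then have Bpos: "0 < B" using U B by (cases "B = 0") auto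
  define rho where "rho = (U / (2 * B * R powr c)) powr (1 / g)"
  have rho: "0 < rho" using U Bpos R by (simp add: rho_def)
  have "(rho ^ DIM('a)) powr s = (U / (2 * B * R powr c)) powr m"
    using rho by (simp add: rho_def powr_powr m mult_ac flip: powr_realpow)
  also have "\<dots> = U powr m / (2 powr m * B powr m * R powr (c * m))"
    using U Bpos R by (simp add: powr_divide powr_mult powr_powr)
  finally have rhos: "(rho ^ DIM('a)) powr s = U powr m / (2 powr m * B powr m * R powr (c * m))" .
  have "R powr (- a) * U / 2 powr (\<bar>a\<bar> + 1) * (v * rho ^ DIM('a)) powr s \<le> N"
    using mass_lower_bound[OF u g Bpos s int x False refl] N by (simp add: R_def U_def v_def rho_def)
  then have "R powr (- a) * U / 2 powr (\<bar>a\<bar> + 1) * (v powr s * (U powr m / (2 powr m * B powr m * R powr (c * m)))) \<le> N"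
    using rho v by (simp add: powr_mult rhos)
  then have "U * U powr m \<le> 2 powr (\<bar>a\<bar> + 1) * 2 powr m / v powr s * (N * B powr m) * (R powr a * R powr (c * m))"
    using R v Bpos by (simp add: powr_minus field_simps)
  then have le: "U powr (1 + m) \<le> 2 powr (\<bar>a\<bar> + 1 + m) / v powr s * (N * B powr m) * R powr (a + m * c)"
    using U by (simp add: powr_add mult_ac)
  have "U = (U powr (1 + m)) powr (1 / (1 + m))" using U m0 by (simp add: powr_powr)
  also have "\<dots> \<le> (2 powr (\<bar>a\<bar> + 1 + m) / v powr s * (N * B powr m) * R powr (a + m * c)) powr (1 / (1 + m))"
    using le m0 U by (intro powr_mono2) auto
  also have "\<dots> = (2 powr (\<bar>a\<bar> + 1 + m) / v powr s) powr (1 / (1 + m))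
    * (N powr (1 / (1 + m)) * B powr (m / (1 + m))) * R powr ((a + m * c) / (1 + m))"
  proof -
    define X where "X = 2 powr (\<bar>a\<bar> + 1 + m) / v powr s"
    have "0 \<le> X" by (simp add: X_def)
    then show ?thesis unfolding X_def[symmetric] using N0 B by (simp add: powr_mult powr_powr)
  qed
  finally show ?thesis by (simp add: R_def U_def v_def)
qed (use assms in \<open>auto intro!: mult_nonneg_nonneg\<close>)

section \<open>Hoelder's inequality for powers\<close>

lemma powr_mult_powr_le:
  fixes x y \<alpha> \<beta> :: real
  assumes "0 \<le> x" "0 \<le> y" "0 < \<alpha>" "0 < \<beta>" "\<alpha> + \<beta> = 1"
  shows "x powr \<alpha> * y powr \<beta> \<le> \<alpha> * x + \<beta> * y"
proof (cases "x = 0 \<or> y = 0")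
  case False
  then show ?thesis using Youngs_inequality_0[of \<alpha> \<beta> x y] assms by simp
qed (use assms in auto)

text \<open>Young's inequality, applied after normalising both integrals to \<open>1\<close>.\<close>

lemma Hoelder_inequality_powr:
  fixes F G :: "'a \<Rightarrow> real"
  assumes F: "integrable M F" "\<And>x. 0 \<le> F x" and G: "integrable M G" "\<And>x. 0 \<le> G x"
    and ab: "0 < \<alpha>" "0 < \<beta>" "\<alpha> + \<beta> = 1"
  shows "integrable M (\<lambda>x. F x powr \<alpha> * G x powr \<beta>)"
    and "(\<integral>x. F x powr \<alpha> * G x powr \<beta> \<partial>M) \<le> (\<integral>x. F x \<partial>M) powr \<alpha> * (\<integral>x. G x \<partial>M) powr \<beta>"
proof -
  have [measurable]: "F \<in> borel_measurable M" "G \<in> borel_measurable M" using F G by auto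
  have young: "F x powr \<alpha> * G x powr \<beta> \<le> \<alpha> * F x + \<beta> * G x" for x
    using powr_mult_powr_le F G ab by simp
  show int: "integrable M (\<lambda>x. F x powr \<alpha> * G x powr \<beta>)"
  proof (rule Bochner_Integration.integrable_bound)
    show "integrable M (\<lambda>x. \<alpha> * F x + \<beta> * G x)" using F G by auto
    show "AE x in M. norm (F x powr \<alpha> * G x powr \<beta>) \<le> norm (\<alpha> * F x + \<beta> * G x)"
      using young F G by (intro always_eventually allI) (simp add: order_trans[OF _ abs_ge_self])
  qed simp
  show "(\<integral>x. F x powr \<alpha> * G x powr \<beta> \<partial>M) \<le> (\<integral>x. F x \<partial>M) powr \<alpha> * (\<integral>x. G x \<partial>M) powr \<beta>"
  proof (cases "(\<integral>x. F x \<partial>M) = 0 \<or> (\<integral>x. G x \<partial>M) = 0")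
    case True
    then have "(AE x in M. F x = 0) \<or> (AE x in M. G x = 0)"
      using integral_nonneg_eq_0_iff_AE[of M F] integral_nonneg_eq_0_iff_AE[of M G] F G by auto
    then have "AE x in M. F x powr \<alpha> * G x powr \<beta> = 0" by auto
    then have "(\<integral>x. F x powr \<alpha> * G x powr \<beta> \<partial>M) = 0" by (rule integral_eq_zero_AE)
    then show ?thesis by simp
  next
    case False
    define P Q where "P = (\<integral>x. F x \<partial>M)" and "Q = (\<integral>x. G x \<partial>M)"
    have "0 \<le> P" "0 \<le> Q" unfolding P_def Q_def using F G by (auto intro: integral_nonneg_AE)
    then have P: "P > 0" and Q: "Q > 0" using False by (auto simp: P_def Q_def)
    have pt: "F x powr \<alpha> * G x powr \<beta> \<le> P powr \<alpha> * Q powr \<beta> * (\<alpha> / P * F x + \<beta> / Q * G x)" for x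
    proof -
      have "F x powr \<alpha> * G x powr \<beta> = P powr \<alpha> * Q powr \<beta> * ((F x / P) powr \<alpha> * (G x / Q) powr \<beta>)"
        using P Q F G by (simp add: powr_divide)
      also have "\<dots> \<le> P powr \<alpha> * Q powr \<beta> * (\<alpha> * (F x / P) + \<beta> * (G x / Q))"
        using powr_mult_powr_le[of "F x / P" "G x / Q" \<alpha> \<beta>] F G ab P Q by (intro mult_left_mono) auto
      finally show ?thesis by simp
    qed
    have "(\<integral>x. F x powr \<alpha> * G x powr \<beta> \<partial>M) \<le> (\<integral>x. P powr \<alpha> * Q powr \<beta> * (\<alpha> / P * F x + \<beta> / Q * G x) \<partial>M)"
      using F G pt by (intro integral_mono int) auto
    also have "\<dots> = P powr \<alpha> * Q powr \<beta> * (\<alpha> / P * P + \<beta> / Q * Q)"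
      using F G by (simp add: P_def Q_def)
    also have "\<dots> = P powr \<alpha> * Q powr \<beta>" using P Q ab by simp
    finally show ?thesis by (simp add: P_def Q_def)
  qed
qed

section \<open>Interpolation along the unified scale\<close>

text \<open>An upper bound \<open>N\<close> for the norm of the scale when \<open>- 1/n < s\<close>, up to a factor of at most \<open>2\<close>. For \<open>s = 0\<close> the bound is
  required everywhere instead of almost everywhere, which is the same for continuous functions.\<close>

definition scale_bound :: "real \<Rightarrow> real \<Rightarrow> ('a::euclidean_space \<Rightarrow> real) \<Rightarrow> bool" where
  "scale_bound s N f \<longleftrightarrow> 0 \<le> N \<and>
     (if s > 0 then
        integrable lebesgue (\<lambda>x. \<bar>f x\<bar> powr (1 / s)) \<and> (\<integral>x. \<bar>f x\<bar> powr (1 / s) \<partial>lebesgue) powr s \<le> N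
      else (\<forall>x. \<bar>f x\<bar> \<le> N) \<and> (s < 0 \<longrightarrow> hoelder_bound (- real DIM('a) * s) N f))"

text \<open>An endpoint \<open>P = (s, a)\<close> pairs the reciprocal exponent with the weight. Both vary affinely with the
  interpolation parameter, so intermediate endpoints are convex combinations of pairs, and reiteration
  becomes an identity in the plane.\<close>

definition weighted_bound :: "real \<times> real \<Rightarrow> real \<Rightarrow> ('a::euclidean_space \<Rightarrow> real) \<Rightarrow> bool" where
  "weighted_bound P N u \<longleftrightarrow> scale_bound (fst P) N (weighted (snd P) u)"

definition interpolates :: "'a::euclidean_space itself \<Rightarrow> real \<times> real \<Rightarrow> real \<times> real \<Rightarrow> real \<Rightarrow> bool" where
  "interpolates _ P Q l \<longleftrightarrow> (\<exists>C\<ge>0. \<forall>u\<in>borel_measurable lebesgue. \<forall>N M.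
     weighted_bound P N (u :: 'a \<Rightarrow> real) \<longrightarrow> weighted_bound Q M u \<longrightarrow>
       weighted_bound ((1 - l) *\<^sub>R P + l *\<^sub>R Q) (C * N powr (1 - l) * M powr l) u)"

lemma interpolatesI:
  assumes "0 \<le> C"
    and "\<And>(u :: 'a::euclidean_space \<Rightarrow> real) N M. u \<in> borel_measurable lebesgue \<Longrightarrow> weighted_bound P N u \<Longrightarrow>
      weighted_bound Q M u \<Longrightarrow> weighted_bound ((1 - l) *\<^sub>R P + l *\<^sub>R Q) (C * N powr (1 - l) * M powr l) u"
  shows "interpolates TYPE('a) P Q l"
  using assms unfolding interpolates_def by blast

lemma weighted_bound_nonneg: "weighted_bound P N u \<Longrightarrow> 0 \<le> N"
  by (simp add: weighted_bound_def scale_bound_def)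

lemma interpolates_sym:
  assumes "interpolates TYPE('a::euclidean_space) P Q l"
  shows "interpolates TYPE('a) Q P (1 - l)"
proof -
  have "(1 - (1 - l)) *\<^sub>R Q + (1 - l) *\<^sub>R P = (1 - l) *\<^sub>R P + l *\<^sub>R Q" by simp
  moreover have "C * M powr (1 - (1 - l)) * N powr (1 - l) = C * N powr (1 - l) * M powr l" for C N M :: real
    by simp
  ultimately show ?thesis using assms unfolding interpolates_def by metis
qed

lemma interpolates_reiterate:
  assumes 1: "interpolates TYPE('a::euclidean_space) P Q \<theta>"
    and 2: "interpolates TYPE('a) P ((1 - \<theta>) *\<^sub>R P + \<theta> *\<^sub>R Q) \<mu>"
  shows "interpolates TYPE('a) P Q (\<theta> * \<mu>)"
proof -
  obtain C where C: "0 \<le> C" and bC: "\<And>(u :: 'a \<Rightarrow> real) N M. u \<in> borel_measurable lebesgue \<Longrightarrow> weighted_bound P N u \<Longrightarrow>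
      weighted_bound Q M u \<Longrightarrow> weighted_bound ((1 - \<theta>) *\<^sub>R P + \<theta> *\<^sub>R Q) (C * N powr (1 - \<theta>) * M powr \<theta>) u"
    using 1 unfolding interpolates_def by blast
  obtain D where D: "0 \<le> D" and bD: "\<And>(u :: 'a \<Rightarrow> real) N M. u \<in> borel_measurable lebesgue \<Longrightarrow> weighted_bound P N u \<Longrightarrow>
      weighted_bound ((1 - \<theta>) *\<^sub>R P + \<theta> *\<^sub>R Q) M u \<Longrightarrow>
      weighted_bound ((1 - \<mu>) *\<^sub>R P + \<mu> *\<^sub>R ((1 - \<theta>) *\<^sub>R P + \<theta> *\<^sub>R Q)) (D * N powr (1 - \<mu>) * M powr \<mu>) u"
    using 2 unfolding interpolates_def by blast
  show ?thesis
  proof (rule interpolatesI[of "D * C powr \<mu>"])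
    fix u :: "'a \<Rightarrow> real" and N M
    assume u: "u \<in> borel_measurable lebesgue" and N: "weighted_bound P N u" and M: "weighted_bound Q M u"
    have point: "(1 - \<mu>) *\<^sub>R P + \<mu> *\<^sub>R ((1 - \<theta>) *\<^sub>R P + \<theta> *\<^sub>R Q) = (1 - \<theta> * \<mu>) *\<^sub>R P + (\<theta> * \<mu>) *\<^sub>R Q"
      by (simp add: algebra_simps)
    have "N powr (1 - \<mu>) * N powr ((1 - \<theta>) * \<mu>) = N powr (1 - \<theta> * \<mu>)"
      by (simp add: algebra_simps flip: powr_add)
    then have "D * N powr (1 - \<mu>) * (C * N powr (1 - \<theta>) * M powr \<theta>) powr \<mu>
        = D * C powr \<mu> * N powr (1 - \<theta> * \<mu>) * M powr (\<theta> * \<mu>)"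
      using C by (simp add: powr_mult powr_powr mult_ac)
    then show "weighted_bound ((1 - \<theta> * \<mu>) *\<^sub>R P + (\<theta> * \<mu>) *\<^sub>R Q)
        (D * C powr \<mu> * N powr (1 - \<theta> * \<mu>) * M powr (\<theta> * \<mu>)) u"
      using bD[OF u N bC[OF u N M]] by (simp only: point)
  qed (use D in simp)
qed

lemma abs_weighted_convex:
  "\<bar>weighted ((1 - l) * a + l * c) u x\<bar> = \<bar>weighted a u x\<bar> powr (1 - l) * \<bar>weighted c u x\<bar> powr l"
proof -
  have "\<bar>u x\<bar> = \<bar>u x\<bar> powr (1 - l) * \<bar>u x\<bar> powr l" by (simp flip: powr_add)
  moreover have "norm x powr (- ((1 - l) * a + l * c)) = (norm x powr (- a)) powr (1 - l) * (norm x powr (- c)) powr l"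
    by (simp add: powr_powr algebra_simps flip: powr_add)
  ultimately show ?thesis by (simp add: weighted_def abs_mult powr_mult mult_ac)
qed

lemma weighted_measurable:
  fixes u :: "'a::euclidean_space \<Rightarrow> real"
  assumes "u \<in> borel_measurable lebesgue"
  shows "weighted a u \<in> borel_measurable lebesgue"
proof -
  have "(\<lambda>x::'a. norm x powr (- a)) \<in> borel_measurable lebesgue"
    by (intro measurable_completion) measurable
  then show ?thesis unfolding weighted_def using assms by (intro borel_measurable_times)
qed

text \<open>The reciprocals of the conjugate exponents are the shares of \<open>(1 - l) s\<close> and \<open>l t\<close> in their sum.\<close>

lemma interpolates_Lp_Lp:
  assumes s: "0 < s" and t: "0 < t" and l: "0 < l" "l < 1"
  shows "interpolates TYPE('a::euclidean_space) (s, a) (t, c) l"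
proof (rule interpolatesI[of 1])
  fix u :: "'a \<Rightarrow> real" and N M
  assume u: "u \<in> borel_measurable lebesgue" and N: "weighted_bound (s, a) N u" and M: "weighted_bound (t, c) M u"
  define q where "q = (1 - l) * s + l * t"
  have q: "q > 0" using s t l by (simp add: q_def add_pos_pos)
  define F G where "F = (\<lambda>x. \<bar>weighted a u x\<bar> powr (1 / s))" and "G = (\<lambda>x. \<bar>weighted c u x\<bar> powr (1 / t))"
  have F: "integrable lebesgue F" "(integral\<^sup>L lebesgue F) powr s \<le> N" "\<And>x. 0 \<le> F x"
    and G: "integrable lebesgue G" "(integral\<^sup>L lebesgue G) powr t \<le> M" "\<And>x. 0 \<le> G x"
    using N M s t by (auto simp: weighted_bound_def scale_bound_def F_def G_def)
  define \<alpha> \<beta> where "\<alpha> = (1 - l) * s / q" and "\<beta> = l * t / q"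
  have ab: "0 < \<alpha>" "0 < \<beta>" "\<alpha> + \<beta> = 1"
    using s t l q by (simp_all add: \<alpha>_def \<beta>_def q_def[symmetric] flip: add_divide_distrib)
  have eq: "\<bar>weighted ((1 - l) * a + l * c) u x\<bar> powr (1 / q) = F x powr \<alpha> * G x powr \<beta>" for x
    using s t by (simp add: abs_weighted_convex powr_mult powr_powr F_def G_def \<alpha>_def \<beta>_def)
  note H = Hoelder_inequality_powr[OF F(1,3) G(1,3) ab]
  have "(\<integral>x. F x powr \<alpha> * G x powr \<beta> \<partial>lebesgue) powr q
      \<le> ((integral\<^sup>L lebesgue F) powr \<alpha> * (integral\<^sup>L lebesgue G) powr \<beta>) powr q"
    using q by (intro powr_mono2 H(2)) (auto intro!: integral_nonneg_AE)
  also have "\<dots> = ((integral\<^sup>L lebesgue F) powr s) powr (1 - l) * ((integral\<^sup>L lebesgue G) powr t) powr l"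
    using q by (simp add: powr_mult powr_powr \<alpha>_def \<beta>_def mult_ac)
  also have "\<dots> \<le> N powr (1 - l) * M powr l"
    using F(2) G(2) l by (intro mult_mono powr_mono2) auto
  finally show "weighted_bound ((1 - l) *\<^sub>R (s, a) + l *\<^sub>R (t, c)) (1 * N powr (1 - l) * M powr l) u"
    using q H(1) by (simp add: weighted_bound_def scale_bound_def eq q_def[symmetric])
qed simp

lemma interpolates_Lp_sup:
  assumes s: "0 < s" and l: "0 < l" "l < 1"
  shows "interpolates TYPE('a::euclidean_space) (s, a) (0, c) l"
proof (rule interpolatesI[of 1])
  fix u :: "'a \<Rightarrow> real" and N M
  assume u: "u \<in> borel_measurable lebesgue" and N: "weighted_bound (s, a) N u" and M: "weighted_bound (0, c) M u"
  define q where "q = (1 - l) * s"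
  have q: "q > 0" using s l by (simp add: q_def)
  define F where "F = (\<lambda>x. \<bar>weighted a u x\<bar> powr (1 / s))"
  define G where "G = (\<lambda>x. \<bar>weighted ((1 - l) * a + l * c) u x\<bar> powr (1 / q))"
  have F: "integrable lebesgue F" "(integral\<^sup>L lebesgue F) powr s \<le> N" "\<And>x. 0 \<le> F x"
    using N s by (auto simp: weighted_bound_def scale_bound_def F_def)
  have M0: "0 \<le> M" and Mb: "\<And>x. \<bar>weighted c u x\<bar> \<le> M" using M by (auto simp: weighted_bound_def scale_bound_def)
  have le: "G x \<le> M powr (l / q) * F x" for x
  proof -
    have "G x = F x * \<bar>weighted c u x\<bar> powr (l / q)"
      using s l q by (simp add: G_def abs_weighted_convex powr_mult powr_powr F_def q_def)
    also have "\<dots> \<le> F x * M powr (l / q)"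
      using Mb F(3) l q by (intro mult_left_mono powr_mono2) auto
    finally show ?thesis by (simp add: mult.commute)
  qed
  have [measurable]: "weighted d u \<in> borel_measurable lebesgue" for d using weighted_measurable[OF u] .
  have G: "integrable lebesgue G"
  proof (rule Bochner_Integration.integrable_bound)
    show "integrable lebesgue (\<lambda>x. M powr (l / q) * F x)" using F by auto
    show "AE x in lebesgue. norm (G x) \<le> norm (M powr (l / q) * F x)"
      using le F(3) by (intro always_eventually allI) (simp add: G_def)
  qed (unfold G_def, measurable)
  have "(integral\<^sup>L lebesgue G) powr q \<le> (M powr (l / q) * integral\<^sup>L lebesgue F) powr q"
  proof (intro powr_mono2)
    have "integral\<^sup>L lebesgue G \<le> (\<integral>x. M powr (l / q) * F x \<partial>lebesgue)"
      using F G le by (intro integral_mono) auto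
    then show "integral\<^sup>L lebesgue G \<le> M powr (l / q) * integral\<^sup>L lebesgue F" by simp
    show "0 \<le> integral\<^sup>L lebesgue G" by (intro integral_nonneg_AE) (simp add: G_def)
  qed (use q in simp)
  also have "\<dots> = (integral\<^sup>L lebesgue F) powr q * M powr l"
    using q by (simp add: powr_mult powr_powr)
  also have "\<dots> = ((integral\<^sup>L lebesgue F) powr s) powr (1 - l) * M powr l"
    by (simp add: powr_powr q_def mult.commute)
  also have "\<dots> \<le> N powr (1 - l) * M powr l"
    using F(2) l by (intro mult_right_mono powr_mono2) auto
  finally show "weighted_bound ((1 - l) *\<^sub>R (s, a) + l *\<^sub>R (0, c)) (1 * N powr (1 - l) * M powr l) u"
    using q G by (simp add: weighted_bound_def scale_bound_def q_def[symmetric] G_def)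
qed simp

text \<open>At \<open>s = 0\<close> the sup bound \<open>N\<close> gives oscillation at most \<open>2 N\<close>, which is a Hoelder bound of exponent \<open>0\<close>;
  the factor \<open>2\<close> is kept throughout for uniformity.\<close>

lemma weighted_bound_imp_scaled_hoelder:
  fixes u :: "'a::euclidean_space \<Rightarrow> real"
  assumes u: "weighted_bound (s, a) N u" and s: "s \<le> 0" "- 1 \<le> real DIM('a) * s"
  shows "scaled_hoelder (- real DIM('a) * s) a (weight_const a (- real DIM('a) * s) * (2 * N)) u"
proof (rule scaled_hoelder_of_weighted)
  have N: "0 \<le> N" "\<And>x. \<bar>weighted a u x\<bar> \<le> N" "s < 0 \<Longrightarrow> hoelder_bound (- real DIM('a) * s) N (weighted a u)"
    using u s by (auto simp: weighted_bound_def scale_bound_def)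
  show "hoelder_bound (- real DIM('a) * s) (2 * N) (weighted a u)"
  proof (cases "s = 0")
    case True
    have "\<bar>weighted a u x - weighted a u y\<bar> \<le> 2 * N" for x y
      using N(2)[of x] N(2)[of y] by linarith
    then show ?thesis using True by (simp add: hoelder_bound_def)
  next
    case False
    have "N * d powr (- real DIM('a) * s) \<le> 2 * N * d powr (- real DIM('a) * s)" for d
      using N(1) by (simp add: mult_right_mono)
    then show ?thesis using N(3) False s unfolding hoelder_bound_def by (meson order_trans less_le)
  qed
  show "0 \<le> 2 * N" using N by simp
qed (use s in simp)

text \<open>The sup part of the norm interpolates pointwise; the seminorm passes through \<open>scaled_hoelder\<close>. The
  endpoint \<open>0\<close> is included on either side, so this also covers \<open>L\<^sup>\<infinity>\<close> against a Hoelder space.\<close>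

lemma interpolates_hoelder_hoelder:
  assumes s: "- 1 \<le> real DIM('a) * s" "s \<le> 0" and t: "- 1 \<le> real DIM('a) * t" "t \<le> 0" and l: "0 < l" "l < 1"
  shows "interpolates TYPE('a::euclidean_space) (s, a) (t, c) l"
proof -
  define n where "n = real DIM('a)"
  have n: "0 < n" by (simp add: n_def)
  define b q where "b = (1 - l) * a + l * c" and "q = (1 - l) * s + l * t"
  have q0: "q \<le> 0" using s t l by (simp add: q_def add_nonpos_nonpos mult_nonneg_nonpos)
  have "(1 - l) * (- 1) + l * (- 1) \<le> (1 - l) * (n * s) + l * (n * t)"
    using s t l by (intro add_mono mult_left_mono) (auto simp: n_def)
  then have q1: "- 1 \<le> n * q" by (simp add: q_def algebra_simps)
  define A where "A = 2 * weight_const a (- n * s)"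
  define B where "B = 2 * weight_const c (- n * t)"
  have AB: "0 \<le> A" "0 \<le> B" using weight_const_ge_1[of a "- n * s"] weight_const_ge_1[of c "- n * t"] by (auto simp: A_def B_def)
  define D where "D = weight_const (- b) (b - n * q) + 4"
  have D: "1 \<le> D" using weight_const_ge_1[of "- b" "b - n * q"] by (simp add: D_def)
  define E where "E = A powr (1 - l) * B powr l"
  have E: "0 \<le> E" by (simp add: E_def)
  show ?thesis
  proof (rule interpolatesI[of "1 + D * E"])
    fix u :: "'a \<Rightarrow> real" and N M
    assume N: "weighted_bound (s, a) N u" and M: "weighted_bound (t, c) M u"
    have NM: "0 \<le> N" "0 \<le> M" using N M weighted_bound_nonneg by auto
    define K where "K = N powr (1 - l) * M powr l"
    have K: "0 \<le> K" by (simp add: K_def)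
    have "\<bar>weighted b u x\<bar> \<le> 1 * K" for x
      unfolding b_def abs_weighted_convex K_def mult_1
      using N M s t l by (intro mult_mono powr_mono2) (auto simp: weighted_bound_def scale_bound_def)
    also have "1 * K \<le> (1 + D * E) * K"
      using D E K by (intro mult_right_mono) auto
    finally have sup: "\<bar>weighted b u x\<bar> \<le> (1 + D * E) * K" for x .
    have "scaled_hoelder (- n * s) a (A * N) u" "scaled_hoelder (- n * t) c (B * M) u"
      using weighted_bound_imp_scaled_hoelder[OF N] weighted_bound_imp_scaled_hoelder[OF M] s t
      by (auto simp: n_def A_def B_def mult_ac)
    from scaled_hoelder_interpolate[OF this, of l]
    have "scaled_hoelder (- n * q) b (E * K) u"
      using l AB NM by (simp add: b_def q_def E_def K_def powr_mult mult_ac algebra_simps)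
    from hoelder_of_scaled_hoelder[OF this] have "hoelder_bound (- n * q) (D * (E * K)) (weighted b u)"
      using q0 q1 n E K by (simp add: D_def mult_nonneg_nonpos)
    moreover have "D * (E * K) * d powr e \<le> (1 + D * E) * K * d powr e" for d e
      using K by (intro mult_right_mono) (auto simp: algebra_simps)
    ultimately have "hoelder_bound (- n * q) ((1 + D * E) * K) (weighted b u)"
      unfolding hoelder_bound_def by (meson order_trans)
    then have "scale_bound q ((1 + D * E) * K) (weighted b u)"
      using sup q0 K D E by (simp add: scale_bound_def n_def)
    then show "weighted_bound ((1 - l) *\<^sub>R (s, a) + l *\<^sub>R (t, c)) ((1 + D * E) * N powr (1 - l) * M powr l) u"
      by (simp add: weighted_bound_def b_def q_def K_def mult.assoc)
  qed (use D E in simp)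
qed

text \<open>The parameter \<open>s/(s - t)\<close> is the one at which the interpolated reciprocal exponent vanishes.\<close>

lemma interpolates_Lp_hoelder_sup:
  assumes s: "0 < s" and t: "- 1 \<le> real DIM('a) * t" "t < 0"
  shows "interpolates TYPE('a::euclidean_space) (s, a) (t, c) (s / (s - t))"
proof -
  define n where "n = real DIM('a)"
  have n: "0 < n" by (simp add: n_def)
  define g where "g = - n * t"
  have g: "0 < g" "g \<le> 1" using t n by (auto simp: g_def n_def mult_pos_neg)
  define m where "m = n * s / g"
  have m: "0 < m" using n s g by (simp add: m_def)
  have m_eq: "m = s / (- t)" using n t by (simp add: m_def g_def)
  define l where "l = s / (s - t)"
  have l: "m / (1 + m) = l" "1 / (1 + m) = 1 - l" using s t by (simp_all add: m_eq l_def field_simps)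
  have q: "(1 - l) * s + l * t = 0" using s t by (simp add: l_def field_simps)
  define b where "b = (1 - l) * a + l * c"
  have b: "(a + m * c) / (1 + m) = b" using l unfolding b_def by (metis add_divide_distrib mult.commute times_divide_eq_left mult_1)
  define D where "D = (2 powr (\<bar>a\<bar> + 1 + m) / unit_ball_vol n powr s) powr (1 / (1 + m))"
  define A where "A = 2 * weight_const c g"
  have A: "0 \<le> A" using weight_const_ge_1[of c g] by (simp add: A_def)
  show ?thesis
    unfolding l_def[symmetric]
  proof (rule interpolatesI[of "D * A powr l"])
    fix u :: "'a \<Rightarrow> real" and N M
    assume N: "weighted_bound (s, a) N u" and M: "weighted_bound (t, c) M u"
    have NM: "0 \<le> N" "0 \<le> M" using N M weighted_bound_nonneg by auto
    have int: "integrable lebesgue (\<lambda>x. \<bar>weighted a u x\<bar> powr (1 / s))"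
      and le: "(\<integral>x. \<bar>weighted a u x\<bar> powr (1 / s) \<partial>lebesgue) powr s \<le> N"
      using N s by (auto simp: weighted_bound_def scale_bound_def)
    have h: "scaled_hoelder g c (A * M) u"
      using weighted_bound_imp_scaled_hoelder[OF M] t by (auto simp: n_def A_def g_def mult_ac)
    have "\<bar>weighted b u x\<bar> \<le> D * A powr l * N powr (1 - l) * M powr l" for x
    proof (cases "x = 0")
      case False
      have "\<bar>u x\<bar> \<le> D * (N powr (1 - l) * (A * M) powr l) * norm x powr b"
        using sup_bound_Lp_hoelder[OF h g mult_nonneg_nonneg[OF A NM(2)] s int le m_def[unfolded n_def] False]
        by (simp only: b l D_def n_def)
      then have "norm x powr (- b) * \<bar>u x\<bar> \<le> norm x powr (- b) * (D * (N powr (1 - l) * (A * M) powr l) * norm x powr b)"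
        by (intro mult_left_mono) auto
      also have "\<dots> = D * A powr l * N powr (1 - l) * M powr l"
        using False A NM by (simp add: powr_minus powr_mult)
      finally show ?thesis by (simp add: weighted_def abs_mult)
    qed (simp add: D_def)
    then show "weighted_bound ((1 - l) *\<^sub>R (s, a) + l *\<^sub>R (t, c)) (D * A powr l * N powr (1 - l) * M powr l) u"
      using q by (simp add: weighted_bound_def b_def scale_bound_def D_def)
  qed (simp add: D_def)
qed

text \<open>The sup bound at \<open>\<theta>\<close> divides the segment between the endpoints into a Lebesgue and a Hoelder part; each
  is handled by reiteration, the second one after exchanging the endpoints.\<close>

lemma interpolates_Lp_hoelder:
  assumes s: "0 < s" and t: "- 1 \<le> real DIM('a) * t" "t < 0" and l: "0 < l" "l < 1"
  shows "interpolates TYPE('a::euclidean_space) (s, a) (t, c) l"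
proof -
  define \<theta> where "\<theta> = s / (s - t)"
  have \<theta>: "0 < \<theta>" "\<theta> < 1" using s t by (auto simp: \<theta>_def)
  have sup: "interpolates TYPE('a) (s, a) (t, c) \<theta>"
    unfolding \<theta>_def using s t by (rule interpolates_Lp_hoelder_sup)
  have "(1 - \<theta>) * s + \<theta> * t = 0" using s t by (simp add: \<theta>_def field_simps)
  then have point: "(1 - \<theta>) *\<^sub>R (s, a) + \<theta> *\<^sub>R (t, c) = (0, (1 - \<theta>) * a + \<theta> * c)" by simp
  consider "l < \<theta>" | "l = \<theta>" | "\<theta> < l" by linarith
  then show ?thesis
  proof cases
    case 1
    have "interpolates TYPE('a) (s, a) ((1 - \<theta>) *\<^sub>R (s, a) + \<theta> *\<^sub>R (t, c)) (l / \<theta>)"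
      unfolding point using s l \<theta> 1 by (intro interpolates_Lp_sup) auto
    from interpolates_reiterate[OF sup this] show ?thesis using \<theta> by simp
  next
    case 2
    then show ?thesis using sup by simp
  next
    case 3
    have "interpolates TYPE('a) (t, c) ((1 - (1 - \<theta>)) *\<^sub>R (t, c) + (1 - \<theta>) *\<^sub>R (s, a)) ((1 - l) / (1 - \<theta>))"
      using t l \<theta> 3 point by (subst add.commute) (auto intro!: interpolates_hoelder_hoelder)
    from interpolates_reiterate[OF interpolates_sym[OF sup] this]
    have "interpolates TYPE('a) (t, c) (s, a) (1 - l)" using \<theta> by simp
    from interpolates_sym[OF this] show ?thesis by simp
  qed
qed

lemma interpolates_unified_scale:
  assumes s: "- 1 \<le> real DIM('a) * s" and t: "- 1 \<le> real DIM('a) * t" and l: "0 < l" "l < 1"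
  shows "interpolates TYPE('a::euclidean_space) (s, a) (t, c) l"
proof -
  have *: "interpolates TYPE('a) (s, a) (t, c) l"
    if "- 1 \<le> real DIM('a) * t" "0 < s" "0 < l" "l < 1" for s t a c l
    using that interpolates_Lp_Lp interpolates_Lp_sup interpolates_Lp_hoelder
    by (metis linorder_less_linear)
  consider "0 < s" | "0 < t" | "s \<le> 0" "t \<le> 0" by linarith
  then show ?thesis
  proof cases
    case 1 then show ?thesis using * t l by blast
  next
    case 2
    then have "interpolates TYPE('a) (t, c) (s, a) (1 - l)" using * s l by simp
    from interpolates_sym[OF this] show ?thesis by simp
  next
    case 3
    then show ?thesis using s t l by (intro interpolates_hoelder_hoelder)
  qed
qed

section \<open>Lipschitz functions supported in an annulus\<close>

text \<open>The support is contained in an annulus \<open>r \<le> \<bar>x\<bar> \<le> R\<close>, on which every power of \<open>\<bar>x\<bar>\<close> is bounded; this makes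
  multiplication by power weights harmless.\<close>

definition lipschitz_off_origin :: "('a::real_normed_vector \<Rightarrow> real) \<Rightarrow> bool" where
  "lipschitz_off_origin u \<longleftrightarrow>
     (\<exists>L\<ge>0. \<forall>x y. \<bar>u x - u y\<bar> \<le> L * norm (x - y)) \<and>
     (\<exists>r>0. \<exists>R. \<forall>x. u x \<noteq> 0 \<longrightarrow> r \<le> norm x \<and> norm x \<le> R)"

lemma powr_le_annulus:
  fixes r \<rho> R m :: real
  assumes "0 < r" "r \<le> \<rho>" "\<rho> \<le> R"
  shows "\<rho> powr m \<le> r powr m + R powr m"
proof (cases "0 \<le> m")
  case True
  then have "\<rho> powr m \<le> R powr m" using assms by (intro powr_mono2) auto
  then show ?thesis using powr_ge_zero[of r m] by linarith
next
  case False
  then have "\<rho> powr m \<le> r powr m" using assms by (intro powr_mono2') auto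
  then show ?thesis using powr_ge_zero[of R m] by linarith
qed

text \<open>If \<open>u x \<noteq> 0\<close> or \<open>u y \<noteq> 0\<close>, then \<open>\<bar>x\<bar>\<close> lies in a slightly larger annulus, where \<open>\<bar>x - y\<bar>\<close> is bounded by
  \<open>\<bar>x\<bar>\<^sup>1\<^sup>-\<^sup>g \<bar>x - y\<bar>\<^sup>g\<close> and the surplus power of \<open>\<bar>x\<bar>\<close> by a constant.\<close>

lemma scaled_hoelder_of_lipschitz:
  fixes u :: "'a::real_normed_vector \<Rightarrow> real"
  assumes u: "lipschitz_off_origin u" and g: "0 \<le> g" "g \<le> 1"
  obtains A where "0 \<le> A" "scaled_hoelder g e A u"
proof -
  from u obtain L where L: "0 \<le> L" "\<And>x y. \<bar>u x - u y\<bar> \<le> L * norm (x - y)"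
    unfolding lipschitz_off_origin_def by blast
  from u obtain r R where r: "0 < r" and supp: "\<And>x. u x \<noteq> 0 \<Longrightarrow> r \<le> norm x \<and> norm x \<le> R"
    unfolding lipschitz_off_origin_def by blast
  have u0: "u 0 = 0" using supp[of 0] r by auto
  \<comment> \<open>\<open>V\<close> serves points \<open>x\<close> with \<open>u x \<noteq> 0\<close>, and \<open>W\<close> the points \<open>x\<close> with such a point within distance \<open>\<bar>x\<bar>/2\<close>.\<close>
  define W where "W = (r / 2) powr (1 - g - e) + (2 * R) powr (1 - g - e)"
  have W: "0 \<le> W" by (simp add: W_def)
  define V where "V = r powr (1 - g - e) + R powr (1 - g - e)"
  have V: "0 \<le> V" by (simp add: V_def)
  show ?thesis
  proof (rule that[of "L * (V + W)"])
    show "0 \<le> L * (V + W)" using L V W by simp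
    show "scaled_hoelder g e (L * (V + W)) u"
      unfolding scaled_hoelder_def
    proof (intro conjI allI impI)
      fix x :: 'a assume x: "x \<noteq> 0"
      show "\<bar>u x\<bar> \<le> L * (V + W) * norm x powr (e + g)"
      proof (cases "u x = 0")
        case False
        have "\<bar>u x\<bar> \<le> L * norm x" using L(2)[of x 0] u0 by simp
        also have "norm x = norm x powr (1 - g - e) * norm x powr (e + g)"
          using x by (simp flip: powr_add)
        also have "L * \<dots> \<le> L * ((V + W) * norm x powr (e + g))"
          using powr_le_annulus[of r "norm x" R "1 - g - e"] supp[OF False] r W L
          by (intro mult_left_mono mult_right_mono) (auto simp: V_def)
        finally show ?thesis by (simp add: mult_ac)
      qed (use L V W in simp)
    next
      fix x y :: 'a assume xy: "x \<noteq> 0" "x \<noteq> y" "norm (x - y) \<le> norm x / 2"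
      show "\<bar>u x - u y\<bar> \<le> L * (V + W) * norm x powr e * norm (x - y) powr g"
      proof (cases "u x = 0 \<and> u y = 0")
        case False
        then have ann: "r / 2 \<le> norm x" "norm x \<le> 2 * R"
          using supp[of x] supp[of y] norm_comparable[OF xy(3)] r by (auto; linarith)+
        have le: "norm (x - y) \<le> norm x" using xy(3) norm_ge_zero[of x] by linarith
        have "norm (x - y) = norm (x - y) powr (1 - g) * norm (x - y) powr g"
          using xy by (simp flip: powr_add)
        also have "\<dots> \<le> norm x powr (1 - g) * norm (x - y) powr g"
          using le g by (intro mult_right_mono powr_mono2) auto
        also have "norm x powr (1 - g) = norm x powr (1 - g - e) * norm x powr e"
          by (simp flip: powr_add)
        also have "norm x powr (1 - g - e) * norm x powr e * norm (x - y) powr g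
            \<le> (V + W) * norm x powr e * norm (x - y) powr g"
          using powr_le_annulus[of "r / 2" "norm x" "2 * R" "1 - g - e"] ann r V
          by (intro mult_right_mono) (auto simp: W_def)
        finally have "L * norm (x - y) \<le> L * ((V + W) * norm x powr e * norm (x - y) powr g)"
          using L by (intro mult_left_mono)
        then show ?thesis using L(2)[of x y] by (simp add: mult_ac)
      qed (use L V W in simp)
    qed
  qed
qed

lemma hoelder_bound_weighted_of_lipschitz:
  assumes "lipschitz_off_origin u" "0 \<le> g" "g \<le> 1"
  obtains A where "0 \<le> A" "hoelder_bound g A (weighted b u)"
proof -
  obtain A where A: "0 \<le> A" "scaled_hoelder g b A u"
    using scaled_hoelder_of_lipschitz[OF assms] by blast
  have "0 \<le> (weight_const (- b) (b + g) + 4) * A"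
    using A weight_const_ge_1[of "- b" "b + g"] by simp
  then show ?thesis using that hoelder_of_scaled_hoelder[OF A(2) assms(2,3) A(1)] by blast
qed

lemma continuous_weighted_of_lipschitz:
  assumes "lipschitz_off_origin u"
  shows "continuous_on UNIV (weighted b u)"
proof -
  obtain A where A: "0 \<le> A" "hoelder_bound 1 A (weighted b u)"
    using hoelder_bound_weighted_of_lipschitz[OF assms] by (metis zero_le_one order_refl)
  have "A-lipschitz_on UNIV (weighted b u)"
    using A by (intro lipschitz_onI) (auto simp: hoelder_bound_def dist_norm, metis abs_zero diff_self mult_zero_right norm_zero order_refl)
  then show ?thesis by (rule lipschitz_on_continuous_on)
qed

lemma bounded_weighted_of_lipschitz:
  assumes "lipschitz_off_origin u"
  obtains A where "0 \<le> A" "\<And>x. \<bar>weighted b u x\<bar> \<le> A"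
proof -
  obtain A where A: "0 \<le> A" "hoelder_bound 0 A (weighted b u)"
    using hoelder_bound_weighted_of_lipschitz[OF assms] by (metis zero_le_one order_refl)
  have "\<bar>weighted b u x\<bar> \<le> A" for x
    using A unfolding hoelder_bound_def by (cases "x = 0") (auto dest!: spec2[of _ x 0])
  then show ?thesis using that A by blast
qed

lemma integrable_weighted_of_lipschitz:
  fixes u :: "'a::euclidean_space \<Rightarrow> real"
  assumes u: "lipschitz_off_origin u" and s: "0 < s"
  shows "integrable lebesgue (\<lambda>x. \<bar>weighted b u x\<bar> powr (1 / s))"
proof -
  obtain A where A: "0 \<le> A" "\<And>x. \<bar>weighted b u x\<bar> \<le> A"
    using bounded_weighted_of_lipschitz[OF u] by blast
  obtain R where R: "\<And>x. u x \<noteq> 0 \<Longrightarrow> norm x \<le> R"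
    using u unfolding lipschitz_off_origin_def by blast
  have [measurable]: "weighted b u \<in> borel_measurable lebesgue"
    using continuous_weighted_of_lipschitz[OF u] by (intro measurable_completion) (simp add: borel_measurable_continuous_onI)
  show ?thesis
  proof (rule Bochner_Integration.integrable_bound)
    show "integrable lebesgue (\<lambda>x. A powr (1 / s) * indicat_real (cball (0::'a) R) x)"
      using emeasure_bounded_finite[of "cball (0::'a) R"]
      by (intro integrable_mult_right integrable_real_indicator) auto
    show "AE x in lebesgue. norm (\<bar>weighted b u x\<bar> powr (1 / s)) \<le> norm (A powr (1 / s) * indicat_real (cball (0::'a) R) x)"
    proof (intro always_eventually allI)
      fix x
      show "norm (\<bar>weighted b u x\<bar> powr (1 / s)) \<le> norm (A powr (1 / s) * indicat_real (cball (0::'a) R) x)"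
        using A(2)[of x] s R[of x]
        by (cases "u x = 0") (auto simp: weighted_def[of b u] indicator_def intro!: powr_mono2)
    qed
  qed measurable
qed

section \<open>Norms of the unified scale as bounds\<close>

lemma mderiv_order_0:
  assumes "(\<Sum>i\<in>UNIV. \<alpha> i) = 0"
  shows "mderiv \<alpha> u = u"
proof -
  have "\<alpha> i = 0" for i using assms by simp
  then have "(\<forall>i. count_list is i = \<alpha> i) \<longleftrightarrow> is = []" for "is" :: "'a list"
    by (auto simp: count_list_0_iff)
  then show ?thesis by (simp add: mderiv_def)
qed

lemma Ck_on_0: "Ck_on 0 S u \<longleftrightarrow> continuous_on S u"
  by (simp add: Ck_on_def)

lemma multiindex_order_0: "{\<alpha> :: 'n \<Rightarrow> nat. \<forall>i. \<alpha> i = 0} = {\<lambda>_. 0}"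
  by auto

lemma minus_1_less_card_mult:
  assumes "- 1 / real CARD('n::finite) < s"
  shows "- 1 < real CARD('n) * s"
  using assms pos_divide_less_eq[of "real CARD('n)" "- 1" s] by (simp add: mult.commute)

lemma hoelder_order_0:
  assumes "- 1 / real CARD('n::finite) < s"
  shows "hoelder_order TYPE('n) s = 0"
proof -
  have "- 1 < real CARD('n) * s" using assms by (rule minus_1_less_card_mult)
  then have "0 \<le> \<lfloor>real CARD('n) * s + 1\<rfloor>" by (simp only: zero_le_floor)
  then show ?thesis by (simp add: hoelder_order_def)
qed

lemma hoelder_exp_eq:
  assumes "- 1 / real CARD('n::finite) < s"
  shows "hoelder_exp TYPE('n) s = - real CARD('n) * s"
  by (simp add: hoelder_exp_def hoelder_order_0[OF assms])

lemma hoelder_quotients_le: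
  assumes "hoelder_bound g A f" "z \<in> hoelder_quotients UNIV g f"
  shows "z \<le> A"
  using assms by (auto simp: hoelder_quotients_def hoelder_bound_def divide_le_eq)

lemma hoelder_quotients_nonempty: "hoelder_quotients (UNIV :: (real^'n) set) g f \<noteq> {}"
proof -
  have "(0 :: real^'n) \<noteq> 1" by simp
  then show ?thesis unfolding hoelder_quotients_def by blast
qed

lemma X_norm_hoelder:
  fixes f :: "real^'n \<Rightarrow> real"
  assumes "- 1 / real CARD('n) < s" "s < 0"
  shows "X_norm s UNIV f = (SUP x. \<bar>f x\<bar>) + Sup (hoelder_quotients UNIV (- real CARD('n) * s) f)"
  using assms by (simp add: X_norm_def hoelder_order_0 hoelder_exp_eq multiindex_order_0 mderiv_order_0)

lemma weighted_in_X_space: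
  fixes u :: "real^'n \<Rightarrow> real"
  assumes u: "lipschitz_off_origin u" and s: "- 1 / real CARD('n) < s"
  shows "weighted b u \<in> X_space s UNIV"
proof -
  have cont: "continuous_on UNIV (weighted b u)" using continuous_weighted_of_lipschitz[OF u] .
  then have meas: "weighted b u \<in> borel_measurable lebesgue"
    by (intro measurable_completion) (simp add: borel_measurable_continuous_onI)
  obtain A where A: "0 \<le> A" "\<And>x. \<bar>weighted b u x\<bar> \<le> A"
    using bounded_weighted_of_lipschitz[OF u] by blast
  consider "0 < s" | "s = 0" | "s < 0" by linarith
  then show ?thesis
  proof cases
    case 1
    then show ?thesis
      using meas integrable_weighted_of_lipschitz[OF u 1] by (simp add: X_space_def lebesgue_on_UNIV_eq)
  next
    case 2
    have "esssup lebesgue (\<lambda>x. ereal \<bar>weighted b u x\<bar>) \<le> ereal A"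
      using A meas by (intro esssup_I) auto
    then have "esssup lebesgue (\<lambda>x. ereal \<bar>weighted b u x\<bar>) < \<infinity>" by (rule le_less_trans) simp
    then show ?thesis using 2 meas by (simp add: X_space_def lebesgue_on_UNIV_eq)
  next
    case 3
    define g where "g = - real CARD('n) * s"
    have "0 \<le> g" "g \<le> 1"
      using minus_1_less_card_mult[OF s] 3 by (auto simp: g_def mult_nonneg_nonpos)
    then obtain B where B: "hoelder_bound g B (weighted b u)"
      using hoelder_bound_weighted_of_lipschitz[OF u] by blast
    have "bdd_above (hoelder_quotients UNIV g (weighted b u))"
      using hoelder_quotients_le[OF B] by (intro bdd_aboveI) blast
    moreover have "bdd_above (range (\<lambda>x. \<bar>weighted b u x\<bar>))"
      using A by (intro bdd_aboveI[of _ A]) auto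
    ultimately show ?thesis
      using 3 s cont by (simp add: X_space_def hoelder_order_0 hoelder_exp_eq mderiv_order_0 Ck_on_0 g_def)
  qed
qed

text \<open>A closed set of full measure is the whole space, so a continuous function is bounded everywhere by its
  essential supremum.\<close>

lemma esssup_continuous:
  fixes f :: "'a::euclidean_space \<Rightarrow> real"
  assumes f: "continuous_on UNIV f" and A: "\<And>x. \<bar>f x\<bar> \<le> A"
  shows "\<exists>e\<le>A. esssup lebesgue (\<lambda>x. ereal \<bar>f x\<bar>) = ereal e \<and> (\<forall>x. \<bar>f x\<bar> \<le> e)"
proof -
  define E where "E = esssup lebesgue (\<lambda>x. ereal \<bar>f x\<bar>)"
  have "f \<in> borel_measurable lebesgue"
    using f by (intro measurable_completion) (simp add: borel_measurable_continuous_onI)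
  then have EA: "E \<le> ereal A" unfolding E_def using A by (intro esssup_I) auto
  have "closed {x. ereal \<bar>f x\<bar> \<le> E}"
    using f by (intro closed_Collect_le continuous_intros) auto
  moreover have "AE x in lebesgue. x \<in> {x. ereal \<bar>f x\<bar> \<le> E}"
    using esssup_AE[of "\<lambda>x. ereal \<bar>f x\<bar>" lebesgue] by (simp add: E_def)
  ultimately have fE: "ereal \<bar>f x\<bar> \<le> E" for x using mem_closed_if_AE_lebesgue by blast
  have "0 \<le> E" using fE[of 0] by (rule order_trans[rotated]) simp
  with EA obtain e where e: "E = ereal e" by (cases E) auto
  show ?thesis using fE EA unfolding E_def[symmetric] e by auto
qed

text \<open>In the Hoelder range the norm is the sum of the sup and the seminorm, so it dominates both; since
  \<open>weighted a u\<close> lies in the space, the suprema and the integral are genuine bounds, not default values.\<close>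

lemma weighted_bound_X_norm:
  fixes u :: "real^'n \<Rightarrow> real"
  assumes u: "lipschitz_off_origin u" and s: "- 1 / real CARD('n) < s"
  shows "weighted_bound (s, a) (X_norm s UNIV (weighted a u)) u"
proof -
  have cont: "continuous_on UNIV (weighted a u)" using continuous_weighted_of_lipschitz[OF u] .
  obtain A where A: "0 \<le> A" "\<And>x. \<bar>weighted a u x\<bar> \<le> A"
    using bounded_weighted_of_lipschitz[OF u] by blast
  consider "0 < s" | "s = 0" | "s < 0" by linarith
  then show ?thesis
  proof cases
    case 1
    then show ?thesis using integrable_weighted_of_lipschitz[OF u 1]
      by (simp add: weighted_bound_def scale_bound_def X_norm_def lebesgue_on_UNIV_eq)
  next
    case 2
    obtain e where e: "esssup lebesgue (\<lambda>x. ereal \<bar>weighted a u x\<bar>) = ereal e" "\<forall>x. \<bar>weighted a u x\<bar> \<le> e"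
      using esssup_continuous[OF cont A(2)] by auto
    moreover have "0 \<le> e" using e(2)[THEN spec, of 0] by simp
    ultimately show ?thesis using 2
      by (simp add: weighted_bound_def scale_bound_def X_norm_def lebesgue_on_UNIV_eq)
  next
    case 3
    define g where "g = - real CARD('n) * s"
    define H where "H = hoelder_quotients UNIV g (weighted a u)"
    have "0 \<le> g" "g \<le> 1"
      using minus_1_less_card_mult[OF s] 3 by (auto simp: g_def mult_nonneg_nonpos)
    then obtain B where B: "hoelder_bound g B (weighted a u)"
      using hoelder_bound_weighted_of_lipschitz[OF u] by blast
    have bddH: "bdd_above H"
      unfolding H_def using hoelder_quotients_le[OF B] by (intro bdd_aboveI) blast
    have bddf: "bdd_above (range (\<lambda>x. \<bar>weighted a u x\<bar>))"
      using A by (intro bdd_aboveI[of _ A]) auto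
    define S where "S = (SUP x. \<bar>weighted a u x\<bar>)"
    have S: "\<bar>weighted a u x\<bar> \<le> S" for x unfolding S_def using bddf by (intro cSUP_upper) auto
    have q: "\<bar>weighted a u x - weighted a u y\<bar> / norm (x - y) powr g \<le> Sup H" if "x \<noteq> y" for x y
      using bddH that by (intro cSup_upper) (auto simp: H_def hoelder_quotients_def)
    have "(0::real^'n) \<noteq> 1" by simp
    from q[OF this] have H0: "0 \<le> Sup H" by (rule order_trans[rotated]) simp
    have S0: "0 \<le> S" using S[of 0] by simp
    have "hoelder_bound g (S + Sup H) (weighted a u)"
      unfolding hoelder_bound_def
    proof (intro allI impI)
      fix x y :: "real^'n" assume xy: "x \<noteq> y"
      then have "\<bar>weighted a u x - weighted a u y\<bar> \<le> Sup H * norm (x - y) powr g"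
        using q[OF xy] by (simp add: divide_le_eq)
      also have "\<dots> \<le> (S + Sup H) * norm (x - y) powr g"
        using S0 by (intro mult_right_mono) auto
      finally show "\<bar>weighted a u x - weighted a u y\<bar> \<le> (S + Sup H) * norm (x - y) powr g" .
    qed
    moreover have "X_norm s UNIV (weighted a u) = S + Sup H"
      by (simp add: X_norm_hoelder[OF s 3] S_def H_def g_def)
    moreover have "\<bar>weighted a u x\<bar> \<le> S + Sup H" for x using S[of x] H0 by linarith
    ultimately show ?thesis
      using 3 H0 S0 by (simp add: weighted_bound_def scale_bound_def g_def)
  qed
qed

text \<open>The factor \<open>2\<close> comes from the Hoelder range, where sup and seminorm are added.\<close>

lemma X_norm_le_weighted_bound:
  fixes u :: "real^'n \<Rightarrow> real"
  assumes u: "lipschitz_off_origin u" and s: "- 1 / real CARD('n) < s" and N: "weighted_bound (s, b) N u"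
  shows "X_norm s UNIV (weighted b u) \<le> 2 * N"
proof -
  have N0: "0 \<le> N" using weighted_bound_nonneg[OF N] .
  consider "0 < s" | "s = 0" | "s < 0" by linarith
  then show ?thesis
  proof cases
    case 1
    then show ?thesis using N N0
      by (simp add: weighted_bound_def scale_bound_def X_norm_def lebesgue_on_UNIV_eq)
  next
    case 2
    then have sup: "\<bar>weighted b u x\<bar> \<le> N" for x using N by (simp add: weighted_bound_def scale_bound_def)
    obtain e where "esssup lebesgue (\<lambda>x. ereal \<bar>weighted b u x\<bar>) = ereal e" "e \<le> N"
      using esssup_continuous[OF continuous_weighted_of_lipschitz[OF u] sup] by auto
    then show ?thesis using 2 N0 by (simp add: X_norm_def lebesgue_on_UNIV_eq)
  next
    case 3
    have "(SUP x. \<bar>weighted b u x\<bar>) \<le> N"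
      using N 3 by (intro cSUP_least) (auto simp: weighted_bound_def scale_bound_def)
    moreover have "Sup (hoelder_quotients UNIV (- real CARD('n) * s) (weighted b u)) \<le> N"
      using N 3 by (intro cSup_least hoelder_quotients_nonempty hoelder_quotients_le)
        (auto simp: weighted_bound_def scale_bound_def)
    ultimately show ?thesis by (simp add: X_norm_hoelder[OF s 3])
  qed
qed

lemma weighted_exponent_0:
  assumes "lipschitz_off_origin u"
  shows "weighted 0 u = u"
proof
  fix x
  have "u 0 = 0" using assms unfolding lipschitz_off_origin_def by force
  then show "weighted 0 u x = u x" by (cases "x = 0") (auto simp: weighted_def)
qed

lemma lipschitz_off_origin_measurable:
  fixes u :: "'a::euclidean_space \<Rightarrow> real"
  assumes u: "lipschitz_off_origin u"
  shows "u \<in> borel_measurable lebesgue"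
  using continuous_weighted_of_lipschitz[OF u, of 0] unfolding weighted_exponent_0[OF u]
  by (intro measurable_completion) (simp add: borel_measurable_continuous_onI)

lemma lipschitz_in_X_weighted:
  fixes u :: "real^'n \<Rightarrow> real"
  assumes u: "lipschitz_off_origin u" and s: "- 1 / real CARD('n) < s"
  shows "u \<in> X_weighted 0 s b UNIV"
proof -
  note meas = lipschitz_off_origin_measurable[OF u]
  have "integrable lebesgue (\<lambda>x. \<bar>u x\<bar>)"
    using integrable_weighted_of_lipschitz[OF u, of 1 0] by (simp add: weighted_exponent_0[OF u])
  then have int: "integrable lebesgue u"
    using meas by (intro integrable_norm_cancel[of lebesgue u]) (simp_all only: real_norm_def)
  have "integrable (lebesgue_on K) u" if "compact K" for K
  proof -
    have "K \<in> sets lebesgue" using that by (simp add: lmeasurable_compact fmeasurableD)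
    then show ?thesis using integrable_mult_indicator[OF _ int] by (simp add: integrable_restrict_space)
  qed
  then have "weak_deriv UNIV \<alpha> u u" if "(\<Sum>i\<in>UNIV. \<alpha> i) = 0" for \<alpha>
    using that by (simp add: weak_deriv_def mderiv_order_0)
  moreover have "AE x in lebesgue_on UNIV. weighted b u x = norm x powr (- b) * u x"
    by (simp add: weighted_def)
  ultimately show ?thesis
    unfolding X_weighted_def using weighted_in_X_space[OF u s, of b] by blast
qed

section \<open>Test functions away from the origin\<close>

text \<open>The partial derivatives are continuous and vanish off the compact support.\<close>

lemma Cc_smooth_partial_bounded:
  fixes u :: "real^'n \<Rightarrow> real"
  assumes u: "u \<in> Cc_smooth \<Omega>"
  obtains L where "0 \<le> L" "\<And>i x. \<bar>partial i u x\<bar> \<le> L"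
proof -
  define K where "K = closure {x. u x \<noteq> 0}"
  have K: "compact K" and Ck: "Ck_on 1 UNIV u" using u by (auto simp: Cc_smooth_def K_def)
  have cont: "continuous_on UNIV (partial i u)" for i
    using Ck unfolding Ck_on_def by (auto dest!: spec[of _ "[i]"])
  have off: "partial i u x = 0" if x: "x \<notin> K" for i x
  proof -
    have "open (- K)" by (simp add: K_def open_Compl)
    then obtain e where e: "0 < e" "ball x e \<subseteq> - K" using x by (meson ComplI openE)
    have "u (x + t *\<^sub>R axis i 1) = 0" if "\<bar>t\<bar> < e" for t
    proof -
      have "x + t *\<^sub>R axis i 1 \<in> ball x e" using that by (simp add: dist_norm)
      then have "x + t *\<^sub>R axis i 1 \<notin> K" using e by blast
      then show ?thesis unfolding K_def using closure_subset[of "{x. u x \<noteq> 0}"] by blast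
    qed
    then have "eventually (\<lambda>t. u (x + t *\<^sub>R axis i 1) = 0) (nhds 0)"
      using e(1) by (auto simp: eventually_nhds_metric dist_norm)
    then have "deriv (\<lambda>t. u (x + t *\<^sub>R axis i 1)) 0 = deriv (\<lambda>t. 0) (0::real)"
      by (rule deriv_cong_ev) simp
    then show ?thesis by (simp add: partial_def)
  qed
  have "\<exists>B. \<forall>x. \<bar>partial i u x\<bar> \<le> B" for i
  proof -
    have "bounded (partial i u ` K)"
      using K cont by (intro compact_imp_bounded compact_continuous_image) (auto intro: continuous_on_subset)
    then obtain B where B: "\<forall>x\<in>K. \<bar>partial i u x\<bar> \<le> B" by (auto simp: bounded_iff)
    have "\<bar>partial i u x\<bar> \<le> \<bar>B\<bar>" for x
      using B off[of x i] by (cases "x \<in> K") force+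
    then show ?thesis by blast
  qed
  then obtain B where B: "\<And>i x. \<bar>partial i u x\<bar> \<le> B i" by metis
  have "\<bar>partial i u x\<bar> \<le> (\<Sum>i\<in>UNIV. \<bar>B i\<bar>)" for i x
  proof -
    have "\<bar>partial i u x\<bar> \<le> \<bar>B i\<bar>" using B[of i x] by linarith
    also have "\<dots> \<le> (\<Sum>i\<in>UNIV. \<bar>B i\<bar>)" by (rule member_le_sum) auto
    finally show ?thesis .
  qed
  then show ?thesis using that[of "\<Sum>i\<in>UNIV. \<bar>B i\<bar>"] by (simp add: sum_nonneg)
qed

lemma Cc_smooth_lipschitz_coordinate:
  fixes u :: "real^'n \<Rightarrow> real"
  assumes u: "u \<in> Cc_smooth \<Omega>" and L: "\<And>i x. \<bar>partial i u x\<bar> \<le> L"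
  shows "\<bar>u (x + t *\<^sub>R axis i 1) - u x\<bar> \<le> L * \<bar>t\<bar>"
proof -
  have Ck: "Ck_on 1 UNIV u" using u by (simp add: Cc_smooth_def)
  define \<phi> where "\<phi> = (\<lambda>t. u (x + t *\<^sub>R axis i 1))"
  have "(\<phi> has_field_derivative partial i u (x + z *\<^sub>R axis i 1)) (at z within UNIV)" for z
  proof -
    have "(\<lambda>h. u ((x + z *\<^sub>R axis i 1) + h *\<^sub>R axis i 1)) differentiable (at 0)"
      using Ck unfolding Ck_on_def by (auto dest: spec[of _ "[]"])
    then have "((\<lambda>h. u ((x + z *\<^sub>R axis i 1) + h *\<^sub>R axis i 1))
        has_field_derivative partial i u (x + z *\<^sub>R axis i 1)) (at 0)"
      unfolding partial_def by (metis DERIV_deriv_iff_real_differentiable)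
    then have "((\<lambda>h. \<phi> (z + h)) has_field_derivative partial i u (x + z *\<^sub>R axis i 1)) (at 0)"
      by (simp add: \<phi>_def algebra_simps)
    then show ?thesis using DERIV_shift[of \<phi> _ 0 z] by (simp add: add.commute)
  qed
  then have "norm (\<phi> t - \<phi> 0) \<le> L * norm (t - 0)"
    using L by (intro field_differentiable_bound[of UNIV]) auto
  then show ?thesis by (simp add: \<phi>_def)
qed

text \<open>The segment from \<open>y\<close> to \<open>x\<close> is replaced by a path along the coordinate directions: \<open>z I\<close> has the
  coordinates of \<open>x\<close> in \<open>I\<close> and those of \<open>y\<close> elsewhere. This uses only the partial derivatives, which are
  what the definition of smoothness provides.\<close>

lemma Cc_smooth_lipschitz:
  fixes u :: "real^'n \<Rightarrow> real"
  assumes u: "u \<in> Cc_smooth \<Omega>"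
  obtains L where "0 \<le> L" "\<And>x y. \<bar>u x - u y\<bar> \<le> L * norm (x - y)"
proof -
  obtain L where L: "0 \<le> L" "\<And>i x. \<bar>partial i u x\<bar> \<le> L"
    using Cc_smooth_partial_bounded[OF u] by blast
  have "\<bar>u x - u y\<bar> \<le> real CARD('n) * L * norm (x - y)" for x y
  proof -
    define z where "z I = (\<chi> j. if j \<in> I then x $ j else y $ j)" for I
    have "\<bar>u (z I) - u y\<bar> \<le> real (card I) * (L * norm (x - y))" for I
    proof (induction I rule: finite_induct[OF finite])
      case 1
      have "z {} = y" by (simp add: z_def vec_eq_iff)
      then show ?case by simp
    next
      case (2 i I)
      have "z (insert i I) = z I + (x $ i - y $ i) *\<^sub>R axis i 1"
        using 2 by (auto simp: z_def vec_eq_iff axis_def)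
      then have "\<bar>u (z (insert i I)) - u (z I)\<bar> \<le> L * \<bar>x $ i - y $ i\<bar>"
        using Cc_smooth_lipschitz_coordinate[OF u L(2)] by metis
      also have "\<dots> \<le> L * norm (x - y)"
        using L(1) component_le_norm_cart[of "x - y" i] by (intro mult_left_mono) auto
      finally show ?case using 2 by (simp add: algebra_simps)
    qed
    from this[of UNIV] have "\<bar>u (z UNIV) - u y\<bar> \<le> real CARD('n) * (L * norm (x - y))" .
    moreover have "z UNIV = x" by (simp add: z_def vec_eq_iff)
    ultimately show ?thesis by (simp add: mult.assoc)
  qed
  then show ?thesis using that[of "real CARD('n) * L"] L by simp
qed

lemma Cc_smooth_lipschitz_off_origin:
  fixes u :: "real^'n \<Rightarrow> real"
  assumes u: "u \<in> Cc_smooth \<Omega>" and \<Omega>: "0 \<notin> \<Omega>"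
  shows "lipschitz_off_origin u"
proof -
  define K where "K = closure {x. u x \<noteq> 0}"
  have K: "compact K" "0 \<notin> K" using u \<Omega> by (auto simp: Cc_smooth_def K_def)
  have "open (- K)" using K(1) by (simp add: compact_imp_closed open_Compl)
  then obtain r where r: "0 < r" "ball 0 r \<subseteq> - K" using K(2) by (meson ComplI openE)
  obtain R where R: "\<And>x. x \<in> K \<Longrightarrow> norm x \<le> R"
    using compact_imp_bounded[OF K(1)] by (auto simp: bounded_iff)
  have "r \<le> norm x \<and> norm x \<le> R" if "u x \<noteq> 0" for x
  proof -
    have "x \<in> K" using that closure_subset[of "{x. u x \<noteq> 0}"] unfolding K_def by blast
    then show ?thesis using r(2) R by (force simp: not_less)
  qed
  then show ?thesis
    unfolding lipschitz_off_origin_def using Cc_smooth_lipschitz[OF u] r(1) by metis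
qed

section \<open>The interpolation inequality\<close>

theorem theorem1p1:
  fixes \<Omega> :: "(real^'n) set"
    and inv_p inv_r inv_q a b c l :: real
  assumes "- 1 / real CARD('n) < inv_p" "inv_p \<le> 1"
    and "- 1 / real CARD('n) < inv_r" "inv_r \<le> 1"
    and "open \<Omega>" "bounded \<Omega>" "0 \<notin> \<Omega>"
    and "0 < l" "l < 1"
    and "inv_q = (1 - l) * inv_p + l * inv_r"
    and "b = (1 - l) * a + l * c"
  shows "\<exists>C>0. \<forall>u\<in>Cc_smooth \<Omega>.
    u \<in> X_weighted 0 inv_p a UNIV \<inter> X_weighted 0 inv_r c UNIV \<longrightarrow>
      u \<in> X_weighted 0 inv_q b UNIV \<and>
      X_norm inv_q UNIV (\<lambda>x. norm x powr (- b) * u x) \<le>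
        C * X_norm inv_p UNIV (\<lambda>x. norm x powr (- a) * u x) powr (1 - l)
          * X_norm inv_r UNIV (\<lambda>x. norm x powr (- c) * u x) powr l"
proof -
  have p: "- 1 \<le> real DIM(real^'n) * inv_p" and r: "- 1 \<le> real DIM(real^'n) * inv_r"
    using minus_1_less_card_mult[OF assms(1)] minus_1_less_card_mult[OF assms(3)] by simp_all
  define d where "d = - 1 / real CARD('n)"
  have "(1 - l) * d < (1 - l) * inv_p" "l * d < l * inv_r"
    unfolding d_def using assms by (intro mult_strict_left_mono; simp)+
  then have "(1 - l) * d + l * d < inv_q" using assms(10) by linarith
  then have "d < inv_q" by (simp add: algebra_simps)
  then have q: "- 1 / real CARD('n) < inv_q" unfolding d_def .
  have "interpolates TYPE(real^'n) (inv_p, a) (inv_r, c) l"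
    using p r assms(8,9) by (rule interpolates_unified_scale)
  moreover have "(1 - l) *\<^sub>R (inv_p, a) + l *\<^sub>R (inv_r, c) = (inv_q, b)"
    using assms(10,11) by simp
  ultimately obtain C where C: "0 \<le> C" and bound: "\<And>(u :: real^'n \<Rightarrow> real) N M. u \<in> borel_measurable lebesgue \<Longrightarrow>
      weighted_bound (inv_p, a) N u \<Longrightarrow> weighted_bound (inv_r, c) M u \<Longrightarrow>
      weighted_bound (inv_q, b) (C * N powr (1 - l) * M powr l) u"
    unfolding interpolates_def by metis
  show ?thesis
  \<comment> \<open>The factor \<open>2\<close> accounts for sup plus seminorm; adding \<open>1\<close> makes the constant positive even if \<open>C = 0\<close>.\<close>
  proof (intro exI[of _ "2 * C + 1"] conjI ballI impI)
    show "0 < 2 * C + 1" using C by simp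
    fix u assume "u \<in> Cc_smooth \<Omega>"
    then have u: "lipschitz_off_origin u" using assms(7) by (rule Cc_smooth_lipschitz_off_origin)
    show "u \<in> X_weighted 0 inv_q b UNIV" using u q by (rule lipschitz_in_X_weighted)
    define N where "N = X_norm inv_p UNIV (weighted a u)"
    define M where "M = X_norm inv_r UNIV (weighted c u)"
    have "weighted_bound (inv_q, b) (C * N powr (1 - l) * M powr l) u"
      unfolding N_def M_def using assms(1,3) u
      by (intro bound weighted_bound_X_norm lipschitz_off_origin_measurable)
    from X_norm_le_weighted_bound[OF u q this]
    have "X_norm inv_q UNIV (weighted b u) \<le> 2 * C * (N powr (1 - l) * M powr l)" by (simp add: mult.assoc)
    also have "\<dots> \<le> (2 * C + 1) * (N powr (1 - l) * M powr l)"
      by (intro mult_right_mono) auto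
    finally show "X_norm inv_q UNIV (\<lambda>x. norm x powr (- b) * u x) \<le>
        (2 * C + 1) * X_norm inv_p UNIV (\<lambda>x. norm x powr (- a) * u x) powr (1 - l)
          * X_norm inv_r UNIV (\<lambda>x. norm x powr (- c) * u x) powr l"
      by (simp add: N_def M_def weighted_def[abs_def] mult.assoc)
  qed
qed

end
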